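(* For a rational number $n$, let $X\subset\mathbb{P}^4_{\mathbb{Q}}$ be the intersection of two quadrics given in affine coordinates $(x,y,u,v)$ by $$xy+x+y-n=u^2,\qquad xy-x-y+n=v^2.$$ For generic $n$ (that is, for all but finitely many rational $n$) the following hold. (1) $X$ is smooth, hence a del Pezzo surface of degree $4$ over $\mathbb{Q}$. (2) Let $\pi\colon X\dashrightarrow\mathbb{P}^1$ be the conic fibration $(x,y,u,v)\mapsto y$, and let $\pi'\colon X'\dashrightarrow\mathbb{P}^1$ be the base-change of $\pi$ along the map $\phi\colon\mathbb{P}^1\to\mathbb{P}^1$, $t\mapsto\dfrac{t^2+1}{t^2-1}$. Then $X'$ is geometrically integral, $\pi'$ has a section over $\mathbb{Q}$, and $X'$ is birational to $\mathbb{P}^2$ over $\mathbb{Q}$. Since $X'$ dominates $X$, there is consequently a dominant rational map $\mathbb{P}^2\dashrightarrow X$ over $\mathbb{Q}$.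
   Context: In homogeneous coordinates $(x:y:u:v:z)$ on $\mathbb{P}^4$, the surface $X$ is given by $xy+xz+yz-nz^2=u^2$, $xy-xz-yz+nz^2=v^2$. Up to birational equivalence, $X'$ is the surface in $(x,t,u,v)$-space obtained by substituting $y=\frac{t^2+1}{t^2-1}$ into the affine equations of $X$, with $\pi'$ the projection to $t$. A section of $\pi'$ is a rational map $\sigma\colon\mathbb{P}^1\dashrightarrow X'$ with $\pi'\circ\sigma=\mathrm{id}$. *)

theory Defs
  imports
    "HOL-Algebra.Algebraic_Closure_Type"
    "HOL-Library.Poly_Mapping"
    "HOL-Library.Numeral_Type"
    "HOL-Library.Infinite_Set"
begin

section \<open>Multivariate polynomials\<close>

text \<open>Polynomials over \<open>'k\<close> in variables indexed by the type \<open>'v\<close>: finitely supported maps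
  from exponent vectors to coefficients, with the ring structure of \<^theory>\<open>HOL-Library.Poly_Mapping\<close>.\<close>

type_synonym ('v, 'k) mpoly = "('v \<Rightarrow>\<^sub>0 nat) \<Rightarrow>\<^sub>0 'k"

definition mvar :: "'v \<Rightarrow> ('v, 'k::comm_ring_1) mpoly" where
  "mvar i = Poly_Mapping.single (Poly_Mapping.single i 1) 1"

definition mconst :: "'k \<Rightarrow> ('v, 'k::comm_ring_1) mpoly" where
  "mconst c = Poly_Mapping.single 0 c"

definition monom_eval :: "('v \<Rightarrow>\<^sub>0 nat) \<Rightarrow> ('v \<Rightarrow> 'k::comm_ring_1) \<Rightarrow> 'k" where
  "monom_eval m p = (\<Prod>i\<in>Poly_Mapping.keys m. p i ^ Poly_Mapping.lookup m i)"

definition meval :: "('v, 'k::comm_ring_1) mpoly \<Rightarrow> ('v \<Rightarrow> 'k) \<Rightarrow> 'k" where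
  "meval f p = (\<Sum>m\<in>Poly_Mapping.keys f. Poly_Mapping.lookup f m * monom_eval m p)"

definition homogeneous :: "nat \<Rightarrow> ('v, 'k::zero) mpoly \<Rightarrow> bool" where
  "homogeneous d f \<longleftrightarrow>
     (\<forall>m\<in>Poly_Mapping.keys f. (\<Sum>i\<in>Poly_Mapping.keys m. Poly_Mapping.lookup m i) = d)"

definition mpderiv :: "'v \<Rightarrow> ('v, 'k::comm_ring_1) mpoly \<Rightarrow> ('v, 'k) mpoly" where
  "mpderiv i f = (\<Sum>m\<in>Poly_Mapping.keys f.
     Poly_Mapping.single (m - Poly_Mapping.single i 1)
       (of_nat (Poly_Mapping.lookup m i) * Poly_Mapping.lookup f m))"

text \<open>Extension of scalars to the algebraic closure.\<close>

definition geom :: "('v, 'k::field) mpoly \<Rightarrow> ('v, 'k alg_closure) mpoly" where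
  "geom f = Poly_Mapping.map to_ac f"

definition ideal2 :: "'r::comm_ring_1 \<Rightarrow> 'r \<Rightarrow> 'r set" where
  "ideal2 f g = {a * f + b * g | a b. True}"

definition is_prime_ideal :: "'r::comm_ring_1 set \<Rightarrow> bool" where
  "is_prime_ideal I \<longleftrightarrow> 1 \<notin> I \<and> (\<forall>a b. a * b \<in> I \<longrightarrow> a \<in> I \<or> b \<in> I)"

text \<open>The affine scheme over \<open>'k\<close> defined by \<open>f = g = 0\<close> is geometrically integral: its coordinate
  ring, tensored with the algebraic closure, is an integral domain.\<close>

definition geometrically_integral :: "('v, 'k::field) mpoly \<Rightarrow> ('v, 'k) mpoly \<Rightarrow> bool" where
  "geometrically_integral f g \<longleftrightarrow> is_prime_ideal (ideal2 (geom f) (geom g))"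


section \<open>Quasi-projective varieties and rational maps\<close>

text \<open>A projective space with homogeneous coordinates indexed by \<open>'v\<close> has dimension
  \<open>CARD('v) - 1\<close>.  Points are represented by their nonzero coordinate vectors, so a subset of
  projective space is a set of nonzero vectors stable under scaling; two vectors represent the same
  point iff they are related by \<open>proj_eq\<close>.  Varieties over \<open>'k\<close> are represented by their points
  over \<open>'k alg_closure\<close>; rational maps over \<open>'k\<close> by polynomials with coefficients in \<open>'k\<close>.\<close>

definition proj_eq :: "('v \<Rightarrow> 'a::field) \<Rightarrow> ('v \<Rightarrow> 'a) \<Rightarrow> bool" where
  "proj_eq p q \<longleftrightarrow> (\<exists>c. c \<noteq> 0 \<and> (\<forall>i. q i = c * p i))"

definition proj_space :: "('v \<Rightarrow> 'a::field) set" where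
  "proj_space = {p. p \<noteq> (\<lambda>_. 0)}"

definition proj_zeros :: "('v, 'a::field) mpoly set \<Rightarrow> ('v \<Rightarrow> 'a) set" where
  "proj_zeros F = {p \<in> proj_space. \<forall>f\<in>F. meval f p = 0}"

definition affine_zeros :: "('v, 'a::field) mpoly set \<Rightarrow> ('v \<Rightarrow> 'a) set" where
  "affine_zeros F = {p. \<forall>f\<in>F. meval f p = 0}"

text \<open>The affine space with coordinates indexed by \<open>'v\<close> as the complement of the hyperplane
  \<open>None = 0\<close> in the projective space with coordinates indexed by \<open>'v option\<close>.\<close>

definition of_affine :: "('v \<Rightarrow> 'a::field) set \<Rightarrow> ('v option \<Rightarrow> 'a) set" where
  "of_affine A = {p. p None \<noteq> 0 \<and> (\<lambda>i. p (Some i) / p None) \<in> A}"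

definition zariski_open_in :: "('v \<Rightarrow> 'a::field) set \<Rightarrow> ('v \<Rightarrow> 'a) set \<Rightarrow> bool" where
  "zariski_open_in V U \<longleftrightarrow> (\<exists>F. (\<forall>f\<in>F. \<exists>d. homogeneous d f) \<and> U = V - proj_zeros F)"

definition zariski_dense_in :: "('v \<Rightarrow> 'a::field) set \<Rightarrow> ('v \<Rightarrow> 'a) set \<Rightarrow> bool" where
  "zariski_dense_in V S \<longleftrightarrow> S \<subseteq> V \<and>
     (\<forall>f d. homogeneous d f \<and> (\<forall>p\<in>S. meval f p = 0) \<longrightarrow> (\<forall>p\<in>V. meval f p = 0))"

definition generically :: "('v \<Rightarrow> 'a::field) set \<Rightarrow> (('v \<Rightarrow> 'a) \<Rightarrow> bool) \<Rightarrow> bool" where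
  "generically V P \<longleftrightarrow> (\<exists>U. zariski_open_in V U \<and> zariski_dense_in V U \<and> (\<forall>p\<in>U. P p))"

definition map_at ::
    "('w \<Rightarrow> ('v, 'k::field) mpoly) \<Rightarrow> ('v \<Rightarrow> 'k alg_closure) \<Rightarrow> ('w \<Rightarrow> 'k alg_closure)" where
  "map_at f p = (\<lambda>j. meval (geom (f j)) p)"

text \<open>As \<open>W\<close> consists of nonzero vectors, \<open>map_at f p \<in> W\<close> includes that the polynomials have no
  common zero at \<open>p\<close>.  On an irreducible quasi-projective variety every rational map is given by
  a single tuple of homogeneous polynomials of equal degree.\<close>

definition rational_map :: "('v \<Rightarrow> 'k::field alg_closure) set \<Rightarrow> ('w \<Rightarrow> 'k alg_closure) set
    \<Rightarrow> ('w \<Rightarrow> ('v, 'k) mpoly) \<Rightarrow> bool" where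
  "rational_map V W f \<longleftrightarrow>
     (\<exists>d. \<forall>j. homogeneous d (f j)) \<and> generically V (\<lambda>p. map_at f p \<in> W)"

definition dominant_rational_map :: "('v \<Rightarrow> 'k::field alg_closure) set \<Rightarrow> ('w \<Rightarrow> 'k alg_closure) set
    \<Rightarrow> ('w \<Rightarrow> ('v, 'k) mpoly) \<Rightarrow> bool" where
  "dominant_rational_map V W f \<longleftrightarrow>
     rational_map V W f \<and> zariski_dense_in W (map_at f ` {p \<in> V. map_at f p \<in> W})"

definition birational ::
    "('v \<Rightarrow> 'k::field alg_closure) set \<Rightarrow> ('w \<Rightarrow> 'k alg_closure) set \<Rightarrow> bool" where
  "birational V W \<longleftrightarrow> (\<exists>f g. rational_map V W f \<and> rational_map W V g \<and>
     generically V (\<lambda>p. proj_eq p (map_at g (map_at f p))) \<and>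
     generically W (\<lambda>q. proj_eq q (map_at f (map_at g q))))"

definition rational_section :: "('v \<Rightarrow> 'k::field alg_closure) set \<Rightarrow> ('w \<Rightarrow> 'k alg_closure) set
    \<Rightarrow> ('w \<Rightarrow> ('v, 'k) mpoly) \<Rightarrow> ('v \<Rightarrow> ('w, 'k) mpoly) \<Rightarrow> bool" where
  "rational_section V B pr s \<longleftrightarrow> rational_map V B pr \<and> rational_map B V s \<and>
     generically B (\<lambda>b. proj_eq b (map_at pr (map_at s b)))"


section \<open>Smoothness and quartic del Pezzo surfaces\<close>

text \<open>Jacobian criterion for the projective scheme \<open>f = g = 0\<close>, of codimension 2: the Jacobian
  matrix has rank 2 at every geometric point.\<close>

definition smooth_codim2 :: "('v, 'k::field) mpoly \<Rightarrow> ('v, 'k) mpoly \<Rightarrow> bool" where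
  "smooth_codim2 f g \<longleftrightarrow> (\<forall>p \<in> proj_zeros {geom f, geom g}. \<forall>a b.
     (\<forall>i. a * meval (mpderiv i (geom f)) p + b * meval (mpderiv i (geom g)) p = 0)
       \<longrightarrow> a = 0 \<and> b = 0)"

text \<open>A del Pezzo surface of degree 4 in its anticanonical embedding: a smooth, geometrically
  integral complete intersection of two quadrics in projective 4-space.  The fourth and fifth
  conditions say that \<open>f, g\<close> is a regular sequence; geometric integrality is that of the homogeneous
  coordinate ring.  By adjunction the anticanonical class of such a surface is the hyperplane class,
  of self-intersection 4.\<close>

definition del_Pezzo_degree_4 :: "('v::finite, 'k::field) mpoly \<Rightarrow> ('v, 'k) mpoly \<Rightarrow> bool" where
  "del_Pezzo_degree_4 f g \<longleftrightarrow>
     CARD('v) = 5 \<and> homogeneous 2 f \<and> homogeneous 2 g \<and>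
     f \<noteq> 0 \<and> (\<forall>h. f dvd g * h \<longrightarrow> f dvd h) \<and>
     geometrically_integral f g \<and> smooth_codim2 f g"


section \<open>The surfaces\<close>

text \<open>Homogeneous coordinates \<open>(x : y : u : v : z)\<close>.\<close>

datatype coord = Cx | Cy | Cu | Cv | Cz

instance coord :: finite
proof
  have "(UNIV :: coord set) = {Cx, Cy, Cu, Cv, Cz}"
    using coord.exhaust by auto
  then show "finite (UNIV :: coord set)"
    using finite.simps by auto
qed

definition X_eq1 :: "rat \<Rightarrow> (coord, rat) mpoly" where
  "X_eq1 n = (let x = mvar Cx; y = mvar Cy; u = mvar Cu; z = mvar Cz in
     x * y + x * z + y * z - mconst n * z^2 - u^2)"

definition X_eq2 :: "rat \<Rightarrow> (coord, rat) mpoly" where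
  "X_eq2 n = (let x = mvar Cx; y = mvar Cy; v = mvar Cv; z = mvar Cz in
     x * y - x * z - y * z + mconst n * z^2 - v^2)"

definition surface_X :: "rat \<Rightarrow> (coord \<Rightarrow> rat alg_closure) set" where
  "surface_X n = proj_zeros {geom (X_eq1 n), geom (X_eq2 n)}"

text \<open>Affine coordinates \<open>(x, t, u, v)\<close>.  The equations are those of the affine part of \<open>surface_X\<close> with
  \<open>y = (t^2 + 1) / (t^2 - 1)\<close>, multiplied by \<open>t^2 - 1\<close>.  Clearing denominators does not change the
  scheme: modulo \<open>t^2 - 1\<close> the two polynomials become \<open>2 (x + 1)\<close> and \<open>2 (x - 1)\<close>, so they generate
  the unit ideal together with \<open>t^2 - 1\<close> (cf. \<open>affine_X'_iff\<close> below).\<close>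

datatype coord' = Dx | Dt | Du | Dv

definition X'_eq1 :: "rat \<Rightarrow> (coord', rat) mpoly" where
  "X'_eq1 n = (let x = mvar Dx; t = mvar Dt; u = mvar Du in
     x * (t^2 + 1) + x * (t^2 - 1) + (t^2 + 1) - mconst n * (t^2 - 1) - u^2 * (t^2 - 1))"

definition X'_eq2 :: "rat \<Rightarrow> (coord', rat) mpoly" where
  "X'_eq2 n = (let x = mvar Dx; t = mvar Dt; v = mvar Dv in
     x * (t^2 + 1) - x * (t^2 - 1) - (t^2 + 1) + mconst n * (t^2 - 1) - v^2 * (t^2 - 1))"

definition surface_X' :: "rat \<Rightarrow> (coord' option \<Rightarrow> rat alg_closure) set" where
  "surface_X' n = of_affine (affine_zeros {geom (X'_eq1 n), geom (X'_eq2 n)})"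

text \<open>On projective lines, with coordinates \<open>(0 : 1)\<close>, the affine coordinate is the quotient of
  coordinate \<open>0\<close> by coordinate \<open>1\<close>.\<close>

definition proj_y :: "2 \<Rightarrow> (coord, rat) mpoly" where
  "proj_y j = (if j = 0 then mvar Cy else mvar Cz)"

definition proj_t :: "2 \<Rightarrow> (coord' option, rat) mpoly" where
  "proj_t j = (if j = 0 then mvar (Some Dt) else mvar None)"

definition phi :: "2 \<Rightarrow> (2, rat) mpoly" where
  "phi j = (if j = 0 then mvar 0 ^ 2 + mvar 1 ^ 2 else mvar 0 ^ 2 - mvar 1 ^ 2)"

text \<open>The base-change projection \<open>(x, t, u, v) \<mapsto> (x, (t^2 + 1) / (t^2 - 1), u, v)\<close>.\<close>

fun X'_to_X :: "coord \<Rightarrow> (coord' option, rat) mpoly" where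
  "X'_to_X Cx = mvar (Some Dx) * (mvar (Some Dt) ^ 2 - mvar None ^ 2)"
| "X'_to_X Cy = mvar None * (mvar (Some Dt) ^ 2 + mvar None ^ 2)"
| "X'_to_X Cu = mvar (Some Du) * (mvar (Some Dt) ^ 2 - mvar None ^ 2)"
| "X'_to_X Cv = mvar (Some Dv) * (mvar (Some Dt) ^ 2 - mvar None ^ 2)"
| "X'_to_X Cz = mvar None * (mvar (Some Dt) ^ 2 - mvar None ^ 2)"


section \<open>Evaluation is a ring homomorphism\<close>

lemma monom_eval_superset:
  assumes "finite A" "Poly_Mapping.keys m \<subseteq> A"
  shows "monom_eval m p = (\<Prod>i\<in>A. p i ^ Poly_Mapping.lookup m i)"
  unfolding monom_eval_def
  by (rule prod.mono_neutral_left) (use assms in \<open>auto simp: in_keys_iff\<close>)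

lemma monom_eval_add: "monom_eval (m + m') p = monom_eval m p * monom_eval m' p"
proof -
  let ?A = "Poly_Mapping.keys m \<union> Poly_Mapping.keys m'"
  have "monom_eval (m + m') p = (\<Prod>i\<in>?A. p i ^ Poly_Mapping.lookup (m + m') i)"
    by (rule monom_eval_superset) (use Poly_Mapping.keys_add[of m m'] in auto)
  also have "\<dots> = (\<Prod>i\<in>?A. p i ^ Poly_Mapping.lookup m i) * (\<Prod>i\<in>?A. p i ^ Poly_Mapping.lookup m' i)"
    by (simp add: lookup_add power_add prod.distrib)
  also have "\<dots> = monom_eval m p * monom_eval m' p"
    using monom_eval_superset[of ?A m p] monom_eval_superset[of ?A m' p] by simp
  finally show ?thesis .
qed

lemma meval_superset:
  assumes "finite A" "Poly_Mapping.keys f \<subseteq> A"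
  shows "meval f p = (\<Sum>m\<in>A. Poly_Mapping.lookup f m * monom_eval m p)"
  unfolding meval_def
  by (rule sum.mono_neutral_left) (use assms in \<open>auto simp: in_keys_iff\<close>)

lemma meval_0 [simp]: "meval 0 p = 0"
  by (simp add: meval_def)

lemma meval_single [simp]: "meval (Poly_Mapping.single m c) p = c * monom_eval m p"
  by (simp add: meval_def)

lemma meval_mvar [simp]: "meval (mvar i) p = p i"
  by (simp add: mvar_def monom_eval_def)

lemma meval_mconst [simp]: "meval (mconst c) p = c"
  by (simp add: mconst_def monom_eval_def)

lemma meval_1 [simp]: "meval 1 p = 1"
  using meval_mconst[of 1 p] by (simp add: mconst_def)

lemma meval_add [simp]: "meval (f + g) p = meval f p + meval g p"
proof -
  let ?A = "Poly_Mapping.keys f \<union> Poly_Mapping.keys g"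
  have "meval (f + g) p = (\<Sum>m\<in>?A. Poly_Mapping.lookup (f + g) m * monom_eval m p)"
    by (rule meval_superset) (use Poly_Mapping.keys_add[of f g] in auto)
  also have "\<dots> = (\<Sum>m\<in>?A. Poly_Mapping.lookup f m * monom_eval m p)
      + (\<Sum>m\<in>?A. Poly_Mapping.lookup g m * monom_eval m p)"
    by (simp add: lookup_add distrib_right sum.distrib)
  also have "\<dots> = meval f p + meval g p"
    using meval_superset[of ?A f p] meval_superset[of ?A g p] by simp
  finally show ?thesis .
qed

lemma meval_uminus [simp]: "meval (- f) p = - meval f p"
  by (metis add.left_inverse add_eq_0_iff meval_0 meval_add)

lemma meval_diff [simp]: "meval (f - g) p = meval f p - meval g p"
  using meval_add[of f "- g" p] by simp

lemma meval_sum: "meval (\<Sum>i\<in>A. f i) p = (\<Sum>i\<in>A. meval (f i) p)"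
  by (induction A rule: infinite_finite_induct) auto

lemma mpoly_eq_sum_single:
  "f = (\<Sum>m\<in>Poly_Mapping.keys f. Poly_Mapping.single m (Poly_Mapping.lookup f m))"
  for f :: "'a \<Rightarrow>\<^sub>0 'b::comm_monoid_add"
proof (rule poly_mapping_eqI)
  fix k
  show "Poly_Mapping.lookup f k = Poly_Mapping.lookup
     (\<Sum>m\<in>Poly_Mapping.keys f. Poly_Mapping.single m (Poly_Mapping.lookup f m)) k"
    by (simp add: lookup_sum lookup_single when_def in_keys_iff)
qed

lemma meval_mult [simp]: "meval (f * g) p = meval f p * meval g p"
proof -
  have "f * g = (\<Sum>m\<in>Poly_Mapping.keys f. \<Sum>m'\<in>Poly_Mapping.keys g.
      Poly_Mapping.single (m + m') (Poly_Mapping.lookup f m * Poly_Mapping.lookup g m'))"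
    by (subst mpoly_eq_sum_single[of f], subst mpoly_eq_sum_single[of g])
       (simp add: sum_product mult_single)
  then have "meval (f * g) p = (\<Sum>m\<in>Poly_Mapping.keys f. \<Sum>m'\<in>Poly_Mapping.keys g.
      (Poly_Mapping.lookup f m * monom_eval m p) * (Poly_Mapping.lookup g m' * monom_eval m' p))"
    by (simp add: meval_sum monom_eval_add algebra_simps)
  then show ?thesis
    by (simp add: meval_def sum_product)
qed

lemma meval_power [simp]: "meval (f ^ k) p = meval f p ^ k"
  by (induction k) auto

lemma lookup_geom: "Poly_Mapping.lookup (geom f) m = to_ac (Poly_Mapping.lookup f m)"
  by (simp add: geom_def Poly_Mapping.map.rep_eq when_def)

lemma geom_single: "geom (Poly_Mapping.single m c) = Poly_Mapping.single m (to_ac c)"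
  by (rule poly_mapping_eqI) (simp add: lookup_geom lookup_single when_def)

lemma geom_0 [simp]: "geom 0 = 0"
  by (rule poly_mapping_eqI) (simp add: lookup_geom)

lemma geom_mvar [simp]: "geom (mvar i) = mvar i"
  by (simp add: mvar_def geom_single)

lemma geom_mconst [simp]: "geom (mconst c) = mconst (to_ac c)"
  by (simp add: mconst_def geom_single)

lemma geom_1 [simp]: "geom 1 = 1"
  using geom_mconst[of 1] by (simp add: mconst_def)

lemma geom_add [simp]: "geom (f + g) = geom f + geom g"
  by (rule poly_mapping_eqI) (simp add: lookup_geom lookup_add)

lemma geom_diff [simp]: "geom (f - g) = geom f - geom g"
  by (rule poly_mapping_eqI) (simp add: lookup_geom lookup_minus)

lemma geom_sum: "geom (\<Sum>i\<in>A. f i) = (\<Sum>i\<in>A. geom (f i))"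
  by (induction A rule: infinite_finite_induct) auto

lemma geom_mult [simp]: "geom (f * g) = geom f * geom g"
proof -
  have keys: "Poly_Mapping.keys (geom h) = Poly_Mapping.keys h" for h :: "('a, 'b) mpoly"
    by (auto simp: in_keys_iff lookup_geom)
  have "f * g = (\<Sum>m\<in>Poly_Mapping.keys f. \<Sum>m'\<in>Poly_Mapping.keys g.
      Poly_Mapping.single (m + m') (Poly_Mapping.lookup f m * Poly_Mapping.lookup g m'))"
    by (subst mpoly_eq_sum_single[of f], subst mpoly_eq_sum_single[of g])
       (simp add: sum_product mult_single)
  then have "geom (f * g) = (\<Sum>m\<in>Poly_Mapping.keys f. \<Sum>m'\<in>Poly_Mapping.keys g.
      Poly_Mapping.single (m + m') (to_ac (Poly_Mapping.lookup f m) * to_ac (Poly_Mapping.lookup g m')))"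
    by (simp add: geom_sum geom_single)
  also have "\<dots> = geom f * geom g"
    by (subst (3) mpoly_eq_sum_single, subst (5) mpoly_eq_sum_single)
       (simp add: sum_product mult_single keys lookup_geom)
  finally show ?thesis .
qed

lemma geom_power [simp]: "geom (f ^ k) = geom f ^ k"
  by (induction k) auto


section \<open>The equations of the second surface are those of the base change\<close>

lemma affine_X'_iff:
  fixes p :: "coord' \<Rightarrow> rat alg_closure"
  defines "y \<equiv> ((p Dt)^2 + 1) / ((p Dt)^2 - 1)"
  shows "p \<in> affine_zeros {geom (X'_eq1 n), geom (X'_eq2 n)} \<longleftrightarrow>
    (p Dt)^2 \<noteq> 1 \<and>
    p Dx * y + p Dx + y - to_ac n = (p Du)^2 \<and>
    p Dx * y - p Dx - y + to_ac n = (p Dv)^2"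
proof -
  define N where "N = (p Dt)^2 + 1"
  define D where "D = (p Dt)^2 - 1"
  have zeros: "p \<in> affine_zeros {geom (X'_eq1 n), geom (X'_eq2 n)} \<longleftrightarrow>
      p Dx * N + p Dx * D + N - to_ac n * D - (p Du)^2 * D = 0 \<and>
      p Dx * N - p Dx * D - N + to_ac n * D - (p Dv)^2 * D = 0"
    unfolding affine_zeros_def X'_eq1_def X'_eq2_def Let_def N_def D_def
    by (simp only: mem_Collect_eq ball_simps geom_add geom_diff geom_mult geom_power geom_1
        geom_mvar geom_mconst meval_add meval_diff meval_mult meval_power meval_1 meval_mvar
        meval_mconst simp_thms)
  have D0: "D = 0 \<longleftrightarrow> (p Dt)^2 = 1"
    by (simp add: D_def)
  show ?thesis
  proof (cases "D = 0")
    case True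
    have "N = 2"
      using True by (simp add: N_def D0)
    have "\<not> (x * 2 + 2 = 0 \<and> x * 2 - 2 = 0)" for x :: "rat alg_closure"
    proof (rule notI, elim conjE)
      assume *: "x * 2 + 2 = 0" "x * 2 - 2 = 0"
      have "(4 :: rat alg_closure) = (x * 2 + 2) - (x * 2 - 2)"
        by (simp only: algebra_simps) simp
      then show False unfolding * by simp
    qed
    from this[of "p Dx"] show ?thesis
      unfolding zeros using True D0 \<open>N = 2\<close> by simp
  next
    case False
    have "p Dx * N + p Dx * D + N - to_ac n * D - (p Du)^2 * D
        = D * (p Dx * (N / D) + p Dx + N / D - to_ac n - (p Du)^2)"
      and "p Dx * N - p Dx * D - N + to_ac n * D - (p Dv)^2 * D
        = D * (p Dx * (N / D) - p Dx - N / D + to_ac n - (p Dv)^2)"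
      using False by (simp_all add: algebra_simps)
    then show ?thesis
      unfolding zeros y_def N_def[symmetric] D_def[symmetric] using False D0 by simp
  qed
qed

lemma base_change_square:
  assumes "p \<in> surface_X' n"
  shows "map_at X'_to_X p \<in> surface_X n"
    and "proj_eq (map_at phi (map_at proj_t p)) (map_at proj_y (map_at X'_to_X p))"
proof -
  define w where "w = p None"
  define q where "q = (\<lambda>i. p (Some i) / w)"
  have w: "w \<noteq> 0" and q: "q \<in> affine_zeros {geom (X'_eq1 n), geom (X'_eq2 n)}"
    using assms by (auto simp: surface_X'_def of_affine_def w_def q_def)
  have p: "p (Some i) = w * q i" for i
    using w by (simp add: q_def)
  have t: "(q Dt)^2 \<noteq> 1"
    using q by (simp add: affine_X'_iff)
  have e1: "q Dx * ((q Dt)^2 + 1) + q Dx * ((q Dt)^2 - 1) + ((q Dt)^2 + 1)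
      - to_ac n * ((q Dt)^2 - 1) - (q Du)^2 * ((q Dt)^2 - 1) = 0" (is "?e1 = 0")
    and e2: "q Dx * ((q Dt)^2 + 1) - q Dx * ((q Dt)^2 - 1) - ((q Dt)^2 + 1)
      + to_ac n * ((q Dt)^2 - 1) - (q Dv)^2 * ((q Dt)^2 - 1) = 0" (is "?e2 = 0")
    using q unfolding affine_zeros_def X'_eq1_def X'_eq2_def Let_def
    by (simp_all only: mem_Collect_eq ball_simps geom_add geom_diff geom_mult geom_power geom_1
        geom_mvar geom_mconst meval_add meval_diff meval_mult meval_power meval_1 meval_mvar
        meval_mconst simp_thms)
  let ?r = "map_at X'_to_X p"
  have "?r Cz = w^3 * ((q Dt)^2 - 1)"
    by (simp add: map_at_def p algebra_simps eval_nat_numeral flip: w_def)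
  with w t have "?r Cz \<noteq> 0" by simp
  then have nz: "?r \<in> proj_space"
    by (metis (mono_tags, lifting) mem_Collect_eq proj_space_def)
  have "meval (geom (X_eq1 n)) ?r = w^6 * ((q Dt)^2 - 1) * ?e1"
    by (simp add: X_eq1_def Let_def map_at_def p algebra_simps eval_nat_numeral flip: w_def)
  moreover have "meval (geom (X_eq2 n)) ?r = w^6 * ((q Dt)^2 - 1) * ?e2"
    by (simp add: X_eq2_def Let_def map_at_def p algebra_simps eval_nat_numeral flip: w_def)
  ultimately show "?r \<in> surface_X n"
    using nz e1 e2 by (simp add: surface_X_def proj_zeros_def)
  show "proj_eq (map_at phi (map_at proj_t p)) (map_at proj_y ?r)"
    unfolding proj_eq_def
    by (rule exI[of _ w]) (use w in \<open>auto simp: map_at_def phi_def proj_t_def proj_y_def simp flip: w_def\<close>)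
qed

end

theory Submission
  imports Defs
begin

text \<open>The two equations of the second surface are \<open>u\<^sup>2 D = 2 t\<^sup>2 x + M\<close> and \<open>v\<^sup>2 D = 2 x - M\<close>, where \<open>D = t\<^sup>2 - 1\<close>, \<open>N = t\<^sup>2 + 1\<close>
  and \<open>M = N - n D\<close>.  Eliminating \<open>x\<close> leaves \<open>N M = D (u - t v) (u + t v)\<close>, so the pair
  \<open>(t, a)\<close> with \<open>a = u - t v\<close> is a system of birational coordinates (\<open>birational_X'_plane\<close>), and \<open>a = 1\<close> gives a section of the projection to \<open>t\<close> (\<open>rational_section_X'\<close>).  Composing the parametrisation with the base-change projection
  gives a map from the plane to the first surface which reaches every geometric point with \<open>z y (y\<^sup>2 - z\<^sup>2) (y - n z) \<noteq> 0\<close>,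
  since \<open>t\<close> is found by solving \<open>y = (t\<^sup>2 + 1) / (t\<^sup>2 - 1)\<close>.

  Integrality and density both come from the parametrisation.  A set of points that is the image of an open subset of affine
  space under rational functions is irreducible (\<open>irreducible_set_parametrised\<close>).  Moreover a polynomial vanishing on the
  parametrised points lies in the ideal of the surface
  (\<open>vanishing_on_param_X'_imp_mem_ideal\<close>, \<open>vanishing_on_param_X_imp_mem_ideal\<close>): reduce it modulo the
  equations to degree at most 1 in \<open>u\<close> and, for the first surface, also in \<open>v\<close>, and change the signs of these
  variables.  Together the two facts show that the ideals are prime and the surfaces irreducible, so that nonempty open subsets
  are dense.  These arguments work for every \<open>n\<close>.

  Only smoothness restricts \<open>n\<close>: by the Jacobian criterion the first surface is smooth if \<open>n \<noteq> 0, 1, -1\<close> (\<open>smooth_X\<close>).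
  That its two equations form a regular sequence again follows from division by the first one (\<open>regular_sequence_X\<close>).\<close>

section \<open>Polynomials and their values\<close>

text \<open>The polynomial \<open>f\<close> involves none of the variables in \<open>J\<close>.\<close>

definition free_of :: "'v set \<Rightarrow> ('v, 'k::zero) mpoly \<Rightarrow> bool" where
  "free_of J f \<longleftrightarrow> (\<forall>m\<in>Poly_Mapping.keys f. Poly_Mapping.keys m \<inter> J = {})"

lemma free_of_empty [simp]: "free_of {} f"
  by (simp add: free_of_def)

lemma free_of_0 [simp]: "free_of J 0"
  by (simp add: free_of_def)

lemma free_of_mconst [simp]: "free_of J (mconst c)"
  by (simp add: free_of_def mconst_def)

lemma free_of_1 [simp]: "free_of J (1 :: ('v, 'k::comm_ring_1) mpoly)"
  by (simp add: free_of_def)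

lemma free_of_mvar [simp]: "i \<notin> J \<Longrightarrow> free_of J (mvar i)"
  by (simp add: free_of_def mvar_def)

lemma free_of_add: "free_of J f \<Longrightarrow> free_of J g \<Longrightarrow> free_of J (f + g)"
  using Poly_Mapping.keys_add[of f g] by (auto simp: free_of_def)

lemma free_of_diff: "free_of J f \<Longrightarrow> free_of J g \<Longrightarrow> free_of J (f - g)"
  for f g :: "('v, 'k::comm_ring_1) mpoly"
  using keys_diff[of f g] by (auto simp: free_of_def)

lemma free_of_mult: "free_of J f \<Longrightarrow> free_of J g \<Longrightarrow> free_of J (f * g)"
  unfolding free_of_def
proof
  fix m
  assume f: "\<forall>m\<in>Poly_Mapping.keys f. Poly_Mapping.keys m \<inter> J = {}"
    and g: "\<forall>m\<in>Poly_Mapping.keys g. Poly_Mapping.keys m \<inter> J = {}"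
    and "m \<in> Poly_Mapping.keys (f * g)"
  then obtain a b where "a \<in> Poly_Mapping.keys f" "b \<in> Poly_Mapping.keys g" "m = a + b"
    using keys_mult[of f g] by auto
  with f g show "Poly_Mapping.keys m \<inter> J = {}"
    using Poly_Mapping.keys_add[of a b] by blast
qed

lemma free_of_power: "free_of J f \<Longrightarrow> free_of J (f ^ k)"
  for f :: "('v, 'k::comm_ring_1) mpoly"
  by (induction k) (auto intro: free_of_mult)

lemmas free_of_intros = free_of_add free_of_diff free_of_mult free_of_power

lemma meval_free_of:
  assumes "free_of J f" "\<And>i. i \<notin> J \<Longrightarrow> p i = q i"
  shows "meval f p = meval f q"
  unfolding meval_def monom_eval_def
proof (intro sum.cong refl arg_cong2[where f = times] prod.cong)
  fix m i assume "m \<in> Poly_Mapping.keys f" "i \<in> Poly_Mapping.keys m"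
  then have "i \<notin> J" using assms(1) by (auto simp: free_of_def)
  then show "p i ^ Poly_Mapping.lookup m i = q i ^ Poly_Mapping.lookup m i"
    using assms(2) by simp
qed

lemma free_of_geom: "free_of J f \<Longrightarrow> free_of J (geom f)"
  by (auto simp: free_of_def in_keys_iff lookup_geom)

text \<open>Polynomials without the variables in \<open>J\<close> are built from constants by adding and by multiplying with
  a variable outside \<open>J\<close>.\<close>

lemma mpoly_induct_free [consumes 1, case_names const add var]:
  fixes f :: "('v, 'k::comm_ring_1) mpoly"
  assumes "free_of J f"
    and const: "\<And>c. P (mconst c)"
    and add: "\<And>f g. P f \<Longrightarrow> P g \<Longrightarrow> P (f + g)"
    and var: "\<And>i f. i \<notin> J \<Longrightarrow> P f \<Longrightarrow> P (mvar i * f)"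
  shows "P f"
proof -
  have pow: "P (Poly_Mapping.single (Poly_Mapping.single i k) 1 * g)" if "i \<notin> J" "P g" for i k g
  proof (induction k)
    case 0
    have "Poly_Mapping.single (Poly_Mapping.single i 0) 1 * g = g" by simp
    then show ?case using \<open>P g\<close> by simp
  next
    case (Suc k)
    have "Poly_Mapping.single (Poly_Mapping.single i (Suc k)) 1 * g
        = mvar i * (Poly_Mapping.single (Poly_Mapping.single i k) 1 * g)"
      by (simp add: mvar_def mult_single flip: mult.assoc single_add)
    then show ?case using var[OF that(1) Suc] by simp
  qed
  have mon: "P (Poly_Mapping.single m c)" if "Poly_Mapping.keys m \<inter> J = {}" for m c
  proof -
    have "P (Poly_Mapping.single (\<Sum>i\<in>A. Poly_Mapping.single i (Poly_Mapping.lookup m i)) 1 * mconst c)"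
      if "finite A" "A \<inter> J = {}" for A
      using that
    proof (induction A)
      case empty
      have "Poly_Mapping.single 0 1 * mconst c = mconst c" by simp
      then show ?case using const by simp
    next
      case (insert i A)
      have "Poly_Mapping.single (\<Sum>i\<in>insert i A. Poly_Mapping.single i (Poly_Mapping.lookup m i)) 1 * mconst c
        = Poly_Mapping.single (Poly_Mapping.single i (Poly_Mapping.lookup m i)) 1 *
          (Poly_Mapping.single (\<Sum>i\<in>A. Poly_Mapping.single i (Poly_Mapping.lookup m i)) 1 * mconst c)"
        using insert by (simp add: mult_single flip: mult.assoc)
      then show ?case using insert pow[of i] by simp
    qed
    from this[of "Poly_Mapping.keys m"] show ?thesis
      using that by (simp add: mconst_def mult_single flip: mpoly_eq_sum_single)
  qed
  have "P (\<Sum>m\<in>A. Poly_Mapping.single m (Poly_Mapping.lookup f m))"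
    if "finite A" "A \<subseteq> Poly_Mapping.keys f" for A
    using that
  proof (induction A)
    case empty
    show ?case using const[of 0] by (simp add: mconst_def)
  next
    case (insert m A)
    then show ?case using assms(1) by (auto intro!: add mon simp: free_of_def)
  qed
  from this[of "Poly_Mapping.keys f"] show ?thesis
    by (simp flip: mpoly_eq_sum_single)
qed

lemmas mpoly_induct = mpoly_induct_free[OF free_of_empty, case_names const add var]

lemma monom_eval_mult: "monom_eval m (\<lambda>i. p i * q i) = monom_eval m p * monom_eval m q"
  by (simp add: monom_eval_def power_mult_distrib prod.distrib)

text \<open>Distinct monomials are distinct multiplicative characters, hence linearly independent (Dedekind):
  if the exponents \<open>m\<close>, \<open>m'\<close> differ at \<open>j\<close>, then replacing \<open>f\<close> by \<open>f(q p) - q^m f(p)\<close>, where \<open>q\<close> has coordinate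
  2 at \<open>j\<close> and 1 elsewhere, kills the monomial \<open>m\<close> but not \<open>m'\<close>.\<close>

lemma meval_eq_0_imp_eq_0:
  fixes f :: "('v, 'k::field_char_0) mpoly"
  assumes "\<And>p. meval f p = 0"
  shows "f = 0"
  using assms
proof (induction "card (Poly_Mapping.keys f)" arbitrary: f rule: less_induct)
  case less
  show ?case
  proof (rule ccontr)
    assume "f \<noteq> 0"
    then obtain m where m: "m \<in> Poly_Mapping.keys f" by (metis keys_eq_empty all_not_in_conv)
    show False
    proof (cases "Poly_Mapping.keys f = {m}")
      case True
      then have "meval f (\<lambda>_. 1) = Poly_Mapping.lookup f m"
        by (simp add: meval_def monom_eval_def)
      then show False using less.prems m by (simp add: in_keys_iff)
    next
      case False
      then obtain m' where m': "m' \<in> Poly_Mapping.keys f" "m' \<noteq> m" using m by blast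
      then obtain j where j: "Poly_Mapping.lookup m' j \<noteq> Poly_Mapping.lookup m j"
        by (meson poly_mapping_eqI)
      define q :: "'v \<Rightarrow> 'k" where "q = (\<lambda>i. if i = j then 2 else 1)"
      have q: "monom_eval l q = 2 ^ Poly_Mapping.lookup l j" for l
      proof -
        have "monom_eval l q = (\<Prod>i\<in>insert j (Poly_Mapping.keys l). q i ^ Poly_Mapping.lookup l i)"
          by (rule monom_eval_superset) auto
        also have "\<dots> = (\<Prod>i\<in>{j}. q i ^ Poly_Mapping.lookup l i)"
          by (rule prod.mono_neutral_right) (auto simp: q_def)
        finally show ?thesis by (simp add: q_def)
      qed
      define g where "g = (\<Sum>l\<in>Poly_Mapping.keys f.
        Poly_Mapping.single l ((monom_eval l q - monom_eval m q) * Poly_Mapping.lookup f l))"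
      have lookup_g: "Poly_Mapping.lookup g l = (monom_eval l q - monom_eval m q) * Poly_Mapping.lookup f l" for l
        by (simp add: g_def lookup_sum lookup_single when_def in_keys_iff)
      have "Poly_Mapping.keys g \<subset> Poly_Mapping.keys f"
        using m by (auto simp: in_keys_iff lookup_g)
      then have "card (Poly_Mapping.keys g) < card (Poly_Mapping.keys f)"
        by (simp add: psubset_card_mono)
      moreover have "meval g p = 0" for p
      proof -
        have "meval g p = meval f (\<lambda>i. q i * p i) - monom_eval m q * meval f p"
          unfolding g_def meval_sum meval_single
          by (simp add: meval_def monom_eval_mult sum_distrib_left algebra_simps flip: sum_subtractf)
        then show ?thesis using less.prems by simp
      qed
      ultimately have "g = 0" by (rule less.hyps)
      then have "monom_eval m' q = monom_eval m q"
        using lookup_g[of m'] m' by (simp add: in_keys_iff)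
      then have "(2::'k) ^ Poly_Mapping.lookup m' j = 2 ^ Poly_Mapping.lookup m j"
        by (simp add: q)
      then have "of_nat (2 ^ Poly_Mapping.lookup m' j) = (of_nat (2 ^ Poly_Mapping.lookup m j) :: 'k)"
        by simp
      then have "(2::nat) ^ Poly_Mapping.lookup m' j = 2 ^ Poly_Mapping.lookup m j"
        by (simp only: of_nat_eq_iff)
      with j show False by simp
    qed
  qed
qed

lemma geom_eq_0_iff [simp]: "geom f = 0 \<longleftrightarrow> f = 0"
  by (metis geom_0 lookup_geom lookup_zero poly_mapping_eqI to_ac_eq_0_iff)

lemma monom_eval_scale:
  "monom_eval m (\<lambda>i. c * p i) = c ^ (\<Sum>i\<in>Poly_Mapping.keys m. Poly_Mapping.lookup m i) * monom_eval m p"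
  by (simp add: monom_eval_def power_mult_distrib prod.distrib power_sum)

lemma meval_homogeneous:
  assumes "homogeneous d f"
  shows "meval f (\<lambda>i. c * p i) = c ^ d * meval f p"
  using assms by (simp add: meval_def homogeneous_def monom_eval_scale sum_distrib_left algebra_simps)

text \<open>Conversely, homogeneity can be read off from the values: scaling by 2 suffices, since distinct
  powers of 2 differ.\<close>

lemma homogeneousI:
  fixes f :: "('v, 'k::field_char_0) mpoly"
  assumes "\<And>p. meval f (\<lambda>i. 2 * p i) = 2 ^ d * meval f p"
  shows "homogeneous d f"
proof -
  define g where "g = (\<Sum>m\<in>Poly_Mapping.keys f. Poly_Mapping.single m
    ((2 ^ (\<Sum>i\<in>Poly_Mapping.keys m. Poly_Mapping.lookup m i) - 2 ^ d) * Poly_Mapping.lookup f m))"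
  have "meval g p = meval f (\<lambda>i. 2 * p i) - 2 ^ d * meval f p" for p
  proof -
    have "meval f (\<lambda>i. 2 * p i) = (\<Sum>m\<in>Poly_Mapping.keys f. Poly_Mapping.lookup f m
        * (2 ^ (\<Sum>i\<in>Poly_Mapping.keys m. Poly_Mapping.lookup m i) * monom_eval m p))"
      by (simp add: meval_def monom_eval_scale)
    then show ?thesis
      unfolding g_def meval_sum meval_single
      by (simp add: meval_def sum_distrib_left algebra_simps flip: sum_subtractf)
  qed
  then have "g = 0" using assms by (intro meval_eq_0_imp_eq_0) simp
  show ?thesis
    unfolding homogeneous_def
  proof
    fix m assume m: "m \<in> Poly_Mapping.keys f"
    let ?s = "\<Sum>i\<in>Poly_Mapping.keys m. Poly_Mapping.lookup m i"
    have "Poly_Mapping.lookup g m = (2 ^ ?s - 2 ^ d) * Poly_Mapping.lookup f m"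
      by (simp add: g_def lookup_sum lookup_single when_def in_keys_iff)
    with m \<open>g = 0\<close> have "(2::'k) ^ ?s = 2 ^ d" by (simp add: in_keys_iff)
    then have "of_nat (2 ^ ?s) = (of_nat (2 ^ d) :: 'k)" by simp
    then have "(2::nat) ^ ?s = 2 ^ d" by (simp only: of_nat_eq_iff)
    then show "?s = d" by simp
  qed
qed

lemma homogeneous_mvar: "homogeneous 1 (mvar i :: ('v, 'k::field_char_0) mpoly)"
  by (rule homogeneousI) simp

lemma meval_of_nat [simp]: "meval (of_nat k) p = of_nat k"
  by (induction k) auto

lemma meval_numeral [simp]: "meval (numeral k) p = numeral k"
  using meval_of_nat[of "numeral k" p] by simp

lemma geom_of_nat [simp]: "geom (of_nat k) = of_nat k"
  by (induction k) auto

lemma geom_numeral [simp]: "geom (numeral k) = numeral k"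
  using geom_of_nat[of "numeral k"] by simp

section \<open>Irreducible sets and dense open subsets\<close>

text \<open>Irreducibility of the Zariski closure of \<open>V\<close> in affine space; the empty set is allowed.\<close>

definition irreducible_set :: "('v \<Rightarrow> 'k::field) set \<Rightarrow> bool" where
  "irreducible_set V \<longleftrightarrow> (\<forall>f g. (\<forall>p\<in>V. meval f p * meval g p = 0) \<longrightarrow>
     (\<forall>p\<in>V. meval f p = 0) \<or> (\<forall>p\<in>V. meval g p = 0))"

lemma irreducible_setD:
  assumes "irreducible_set V" "\<And>p. p \<in> V \<Longrightarrow> meval f p = 0 \<or> meval g p = 0"
    and "q \<in> V" "meval g q \<noteq> 0" "p \<in> V"
  shows "meval f p = 0"
  using assms unfolding irreducible_set_def by (metis mult_eq_0_iff)

text \<open>If \<open>f(p) \<noteq> 0\<close> and \<open>g(q) \<noteq> 0\<close>, then neither vanishes identically on the line through \<open>p\<close> and \<open>q\<close>, where both are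
  polynomials in one variable.\<close>

lemma irreducible_set_UNIV: "irreducible_set (UNIV :: ('v \<Rightarrow> 'k::field_char_0) set)"
  unfolding irreducible_set_def
proof (intro allI impI, rule ccontr)
  fix f g :: "('v, 'k) mpoly"
  assume fg: "\<forall>p\<in>UNIV. meval f p * meval g p = 0"
    and "\<not> ((\<forall>p\<in>UNIV. meval f p = 0) \<or> (\<forall>p\<in>UNIV. meval g p = 0))"
  then obtain p q where p: "meval f p \<noteq> 0" and q: "meval g q \<noteq> 0" by auto
  define c where "c i s = p i + s * (q i - p i)" for i s
  have line: "\<exists>P. \<forall>s. poly P s = meval h (\<lambda>i. c i s)" for h
  proof (induction h rule: mpoly_induct)
    case (const a)
    show ?case by (rule exI[of _ "[:a:]"]) simp
  next
    case (add f g)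
    then show ?case by (metis meval_add poly_add)
  next
    case (var i f)
    then obtain P where "\<forall>s. poly P s = meval f (\<lambda>i. c i s)" by auto
    then show ?case
      by (intro exI[of _ "[:p i, q i - p i:] * P"]) (simp add: c_def algebra_simps)
  qed
  obtain P where P: "\<And>s. poly P s = meval f (\<lambda>i. c i s)" using line[of f] by auto
  obtain Q where Q: "\<And>s. poly Q s = meval g (\<lambda>i. c i s)" using line[of g] by auto
  have "poly P 0 \<noteq> 0" "poly Q 1 \<noteq> 0" using p q by (simp_all add: P Q c_def)
  then have "P * Q \<noteq> 0" by auto
  then have "finite {s. poly (P * Q) s = 0}" by (rule poly_roots_finite)
  moreover have "{s. poly (P * Q) s = 0} = UNIV" using fg by (auto simp: P Q)
  ultimately show False by (metis infinite_UNIV_char_0)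
qed

text \<open>Substituting fractions \<open>c i / w\<close> into \<open>h\<close> gives a polynomial over a power of \<open>w\<close>.\<close>

lemma clear_denominators:
  fixes h :: "('v, 'k::field) mpoly" and c :: "'v \<Rightarrow> ('w, 'k) mpoly"
  shows "\<exists>k H. \<forall>q. meval w q \<noteq> 0 \<longrightarrow>
    meval H q = meval w q ^ k * meval h (\<lambda>i. meval (c i) q / meval w q)"
proof (induction h rule: mpoly_induct)
  case (const a)
  show ?case by (rule exI[of _ 0], rule exI[of _ "mconst a"]) simp
next
  case (add f g)
  then obtain k F l G where
    "\<And>q. meval w q \<noteq> 0 \<Longrightarrow> meval F q = meval w q ^ k * meval f (\<lambda>i. meval (c i) q / meval w q)"
    "\<And>q. meval w q \<noteq> 0 \<Longrightarrow> meval G q = meval w q ^ l * meval g (\<lambda>i. meval (c i) q / meval w q)"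
    by blast
  then show ?case
    by (intro exI[of _ "k + l"] exI[of _ "w ^ l * F + w ^ k * G"]) (simp add: power_add algebra_simps)
next
  case (var i f)
  then obtain k F where
    "\<And>q. meval w q \<noteq> 0 \<Longrightarrow> meval F q = meval w q ^ k * meval f (\<lambda>i. meval (c i) q / meval w q)"
    by blast
  then show ?case
    by (intro exI[of _ "Suc k"] exI[of _ "c i * F"]) simp
qed

lemma irreducible_set_parametrised:
  fixes c :: "'v \<Rightarrow> ('w, 'k::field_char_0) mpoly"
  shows "irreducible_set {\<lambda>i. meval (c i) q / meval w q | q. meval w q \<noteq> 0}" (is "irreducible_set ?S")
  unfolding irreducible_set_def
proof (intro allI impI, rule ccontr)
  fix f g
  assume fg: "\<forall>p\<in>?S. meval f p * meval g p = 0"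
    and "\<not> ((\<forall>p\<in>?S. meval f p = 0) \<or> (\<forall>p\<in>?S. meval g p = 0))"
  let ?\<phi> = "\<lambda>q i. meval (c i) q / meval w q"
  obtain a b where a: "meval w a \<noteq> 0" "meval f (?\<phi> a) \<noteq> 0" and b: "meval w b \<noteq> 0" "meval g (?\<phi> b) \<noteq> 0"
    using \<open>\<not> _\<close> by auto
  obtain k F where F: "\<And>q. meval w q \<noteq> 0 \<Longrightarrow> meval F q = meval w q ^ k * meval f (?\<phi> q)"
    using clear_denominators[of w f c] by blast
  obtain l G where G: "\<And>q. meval w q \<noteq> 0 \<Longrightarrow> meval G q = meval w q ^ l * meval g (?\<phi> q)"
    using clear_denominators[of w g c] by blast
  have "meval (F * w) q = 0 \<or> meval (G * w) q = 0" for q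
    using fg F[of q] G[of q] by auto
  moreover have "meval (G * w) b \<noteq> 0"
    using b G[of b] by simp
  ultimately have "meval (F * w) a = 0"
    using irreducible_setD[OF irreducible_set_UNIV, of "F * w" "G * w" b a] by blast
  then show False
    using a F[of a] by simp
qed

text \<open>Irreducibility as tested by homogeneous polynomials, the notion relevant for subsets of
  projective space.\<close>

definition irreducible_cone :: "('v \<Rightarrow> 'k::field) set \<Rightarrow> bool" where
  "irreducible_cone V \<longleftrightarrow> (\<forall>f g d e. homogeneous d f \<longrightarrow> homogeneous e g \<longrightarrow>
     (\<forall>p\<in>V. meval f p * meval g p = 0) \<longrightarrow> (\<forall>p\<in>V. meval f p = 0) \<or> (\<forall>p\<in>V. meval g p = 0))"

lemma irreducible_set_imp_cone: "irreducible_set V \<Longrightarrow> irreducible_cone V"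
  by (auto simp: irreducible_set_def irreducible_cone_def)

lemma irreducible_set_proj_space:
  "irreducible_set (proj_space :: ('v \<Rightarrow> 'k::field_char_0) set)"
  unfolding irreducible_set_def
proof (intro allI impI, rule ccontr)
  fix f g :: "('v, 'k) mpoly"
  assume fg: "\<forall>p\<in>proj_space. meval f p * meval g p = 0"
    and n: "\<not> ((\<forall>p\<in>proj_space. meval f p = 0) \<or> (\<forall>p\<in>proj_space. meval g p = 0))"
  then obtain p q where p: "meval f p \<noteq> 0" and q: "meval g q \<noteq> 0" by auto
  fix i :: 'v
  have "meval g r = 0 \<or> meval (mvar i) r = 0" for r
  proof -
    have "meval (g * mvar i) r = 0 \<or> meval f r = 0" for r
      using fg by (cases "r i = 0") (force simp: proj_space_def)+
    then have "meval (g * mvar i) r = 0"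
      by (rule irreducible_setD[OF irreducible_set_UNIV]) (use p in auto)
    then show ?thesis by simp
  qed
  then have "meval g q = 0"
    by (rule irreducible_setD[OF irreducible_set_UNIV, where q = "\<lambda>_. 1"]) auto
  with q show False by simp
qed

text \<open>Dehomogenising with respect to the coordinate \<open>None\<close>.\<close>

lemma dehomogenise:
  fixes f :: "('v option, 'k::field) mpoly"
  assumes "homogeneous d f"
  shows "\<exists>h. \<forall>p. p None \<noteq> 0 \<longrightarrow> meval f p = p None ^ d * meval h (\<lambda>i. p (Some i) / p None)"
proof -
  have "\<exists>h. \<forall>q. meval h q = meval f (case_option 1 q)"
  proof (induction f rule: mpoly_induct)
    case (const a)
    show ?case by (rule exI[of _ "mconst a"]) simp
  next
    case (add f g)
    then show ?case by (metis meval_add)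
  next
    case (var i f)
    then obtain h where h: "\<forall>q. meval h q = meval f (case_option 1 q)" by blast
    show ?case
      by (rule exI[of _ "(case i of None \<Rightarrow> 1 | Some j \<Rightarrow> mvar j) * h"]) (simp add: h split: option.split)
  qed
  then obtain h where h: "\<And>q. meval h q = meval f (case_option 1 q)" by blast
  have "meval f p = p None ^ d * meval h (\<lambda>i. p (Some i) / p None)" if "p None \<noteq> 0" for p
  proof -
    have "p = (\<lambda>i. p None * case_option 1 (\<lambda>i. p (Some i) / p None) i)"
      using that by (auto simp: fun_eq_iff split: option.split)
    then show ?thesis
      unfolding h by (metis meval_homogeneous[OF assms])
  qed
  then show ?thesis by blast
qed

lemma irreducible_cone_of_affine:
  assumes "irreducible_set A"
  shows "irreducible_cone (of_affine A)"
  unfolding irreducible_cone_def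
proof (intro allI impI)
  fix f g d e
  assume f: "homogeneous d f" and g: "homogeneous e g"
    and fg: "\<forall>p\<in>of_affine A. meval f p * meval g p = 0"
  obtain f' where f': "\<And>p. p None \<noteq> 0 \<Longrightarrow> meval f p = p None ^ d * meval f' (\<lambda>i. p (Some i) / p None)"
    using dehomogenise[OF f] by blast
  obtain g' where g': "\<And>p. p None \<noteq> 0 \<Longrightarrow> meval g p = p None ^ e * meval g' (\<lambda>i. p (Some i) / p None)"
    using dehomogenise[OF g] by blast
  have "meval f' q * meval g' q = 0" if "q \<in> A" for q
  proof -
    have "case_option 1 q \<in> of_affine A" using that by (simp add: of_affine_def)
    then show ?thesis using fg f'[of "case_option 1 q"] g'[of "case_option 1 q"] by auto
  qed
  then have "(\<forall>q\<in>A. meval f' q = 0) \<or> (\<forall>q\<in>A. meval g' q = 0)"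
    using assms by (auto simp: irreducible_set_def)
  then show "(\<forall>p\<in>of_affine A. meval f p = 0) \<or> (\<forall>p\<in>of_affine A. meval g p = 0)"
    using f' g' by (auto simp: of_affine_def)
qed

text \<open>A subset of an irreducible \<open>V\<close> is dense as soon as it is dense in the nonvanishing locus of one
  form \<open>g\<close> that does not vanish identically on \<open>V\<close>.\<close>

lemma zariski_dense_in_nonvanishing:
  assumes "irreducible_cone V" "homogeneous d g" "p0 \<in> V" "meval g p0 \<noteq> 0"
    and "S \<subseteq> V" "\<And>f e p. homogeneous e f \<Longrightarrow> \<forall>q\<in>S. meval f q = 0 \<Longrightarrow> p \<in> V \<Longrightarrow> meval g p \<noteq> 0
      \<Longrightarrow> meval f p = 0"
  shows "zariski_dense_in V S"
  unfolding zariski_dense_in_def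
proof (intro conjI allI impI ballI assms(5))
  fix f e p assume f: "homogeneous e f \<and> (\<forall>p\<in>S. meval f p = 0)" and p: "p \<in> V"
  have "\<forall>p\<in>V. meval f p * meval g p = 0"
    using f assms(6)[of e f] by auto
  then have "(\<forall>p\<in>V. meval f p = 0) \<or> (\<forall>p\<in>V. meval g p = 0)"
    using assms(1,2) f unfolding irreducible_cone_def by blast
  then show "meval f p = 0" using assms(3,4) p by auto
qed

lemma genericallyI:
  assumes "irreducible_cone V" "V \<subseteq> proj_space" "homogeneous d g" "p0 \<in> V" "meval g p0 \<noteq> 0"
    and P: "\<And>p. p \<in> V \<Longrightarrow> meval g p \<noteq> 0 \<Longrightarrow> P p"
  shows "generically V P"
  unfolding generically_def
proof (intro exI conjI ballI)
  let ?U = "V - proj_zeros {g}"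
  show "zariski_open_in V ?U"
    unfolding zariski_open_in_def using assms(3) by blast
  show "zariski_dense_in V ?U"
    using assms(1,3-5) by (rule zariski_dense_in_nonvanishing) (auto simp: proj_zeros_def)
  show "P p" if "p \<in> ?U" for p
    using that assms(2) by (auto simp: proj_zeros_def intro: P)
qed

lemma generically_everywhere:
  assumes "\<And>p. p \<in> V \<Longrightarrow> P p"
  shows "generically V P"
  unfolding generically_def
proof (intro exI conjI ballI)
  show "zariski_open_in V V"
    unfolding zariski_open_in_def
    by (intro exI[of _ "{1}"]) (auto simp: proj_zeros_def homogeneous_def)
qed (use assms in \<open>auto simp: zariski_dense_in_def\<close>)

section \<open>Ideals and normal forms\<close>

lemma ideal2_add: "h \<in> ideal2 f g \<Longrightarrow> h' \<in> ideal2 f g \<Longrightarrow> h + h' \<in> ideal2 f g"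
  unfolding ideal2_def by (smt (verit) add.assoc add.left_commute distrib_right mem_Collect_eq)

lemma ideal2_mult: "h \<in> ideal2 f g \<Longrightarrow> a * h \<in> ideal2 f g"
  unfolding ideal2_def by (smt (verit) distrib_left mem_Collect_eq mult.assoc)

lemma ideal2_dvd: "h \<in> ideal2 f g \<Longrightarrow> h dvd h' \<Longrightarrow> h' \<in> ideal2 f g"
  by (metis dvd_def ideal2_mult mult.commute)

lemma meval_ideal2:
  assumes "h \<in> ideal2 f g" "meval f p = 0" "meval g p = 0"
  shows "meval h p = 0"
  using assms by (auto simp: ideal2_def)

lemma eliminate_linear:
  assumes "free_of {x} c"
  shows "\<exists>a. free_of {x} a \<and> (mvar x - c) dvd (h - a)"
proof (induction h rule: mpoly_induct)
  case (const a)
  show ?case by (rule exI[of _ "mconst a"]) simp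
next
  case (add f g)
  then obtain a b where "free_of {x} a" "(mvar x - c) dvd (f - a)" "free_of {x} b" "(mvar x - c) dvd (g - b)"
    by blast
  then show ?case
    by (intro exI[of _ "a + b"]) (metis add_diff_add dvd_add free_of_add)
next
  case (var i f)
  then obtain a e where a: "free_of {x} a" "f - a = (mvar x - c) * e" by (auto elim: dvdE)
  then have f: "f = a + (mvar x - c) * e" by (simp add: algebra_simps)
  show ?case
  proof (cases "i = x")
    case True
    have "mvar i * f - c * a = (mvar x - c) * (a + mvar x * e)"
      using True by (simp add: f algebra_simps)
    then show ?thesis using a assms by (intro exI[of _ "c * a"]) (simp add: free_of_mult)
  next
    case False
    have "mvar i * f - mvar i * a = (mvar x - c) * (mvar i * e)"
      by (simp add: f algebra_simps)
    then show ?thesis using a False by (intro exI[of _ "mvar i * a"]) (simp add: free_of_mult)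
  qed
qed

text \<open>Pseudo-division by \<open>d u\<^sup>2 - c\<close>: the remainder is linear in \<open>u\<close>, and no variable of \<open>J\<close> is introduced.\<close>

lemma eliminate_square:
  fixes h :: "('v, 'k::comm_ring_1) mpoly"
  assumes "free_of J h" "u \<notin> J" "free_of (insert u J) c" "free_of (insert u J) d"
  shows "\<exists>k a b. free_of (insert u J) a \<and> free_of (insert u J) b \<and>
    (d * mvar u ^ 2 - c) dvd (d ^ k * h - (a + b * mvar u))"
  using assms(1)
proof (induction h rule: mpoly_induct_free)
  case (const a)
  show ?case
    by (rule exI[of _ 0], rule exI[of _ "mconst a"], rule exI[of _ 0]) simp
next
  case (add f g)
  let ?F = "d * mvar u ^ 2 - c"
  obtain k a b e where 1: "free_of (insert u J) a" "free_of (insert u J) b"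
    "d ^ k * f = a + b * mvar u + ?F * e"
    using add(1) by (auto elim!: dvdE simp: diff_eq_eq add.commute)
  obtain l a' b' e' where 2: "free_of (insert u J) a'" "free_of (insert u J) b'"
    "d ^ l * g = a' + b' * mvar u + ?F * e'"
    using add(2) by (auto elim!: dvdE simp: diff_eq_eq add.commute)
  have "d ^ (k + l) * (f + g) = d ^ l * (d ^ k * f) + d ^ k * (d ^ l * g)"
    by (simp add: power_add algebra_simps)
  then have "d ^ (k + l) * (f + g) - ((d ^ l * a + d ^ k * a') + (d ^ l * b + d ^ k * b') * mvar u)
      = ?F * (d ^ l * e + d ^ k * e')"
    unfolding 1 2 by (simp add: algebra_simps)
  then show ?case
    using 1(1,2) 2(1,2) assms(4)
    by (intro exI[of _ "k + l"] exI[of _ "d ^ l * a + d ^ k * a'"] exI[of _ "d ^ l * b + d ^ k * b'"])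
      (simp add: free_of_intros)
next
  case (var i f)
  let ?F = "d * mvar u ^ 2 - c"
  obtain k a b e where 1: "free_of (insert u J) a" "free_of (insert u J) b"
    "d ^ k * f = a + b * mvar u + ?F * e"
    using var(2) by (auto elim!: dvdE simp: diff_eq_eq add.commute)
  show ?case
  proof (cases "i = u")
    case True
    have "d ^ Suc k * (mvar i * f) = d * mvar u * (d ^ k * f)"
      using True by (simp add: algebra_simps)
    then have "d ^ Suc k * (mvar i * f) - (b * c + d * a * mvar u) = ?F * (b + d * mvar u * e)"
      unfolding 1 by (simp add: algebra_simps power2_eq_square)
    then show ?thesis
      using 1(1,2) assms(3,4)
      by (intro exI[of _ "Suc k"] exI[of _ "b * c"] exI[of _ "d * a"]) (simp add: free_of_intros)
  next
    case False
    have "d ^ k * (mvar i * f) = mvar i * (d ^ k * f)"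
      by (simp add: algebra_simps)
    then have "d ^ k * (mvar i * f) - (mvar i * a + mvar i * b * mvar u) = ?F * (mvar i * e)"
      unfolding 1 by (simp add: algebra_simps)
    then show ?thesis
      using 1(1,2) False var(1)
      by (intro exI[of _ k] exI[of _ "mvar i * a"] exI[of _ "mvar i * b"]) (simp add: free_of_intros)
  qed
qed

section \<open>Partial derivatives\<close>

lemma mpderiv_superset:
  assumes "finite A" "Poly_Mapping.keys f \<subseteq> A"
  shows "mpderiv i f = (\<Sum>m\<in>A. Poly_Mapping.single (m - Poly_Mapping.single i 1)
       (of_nat (Poly_Mapping.lookup m i) * Poly_Mapping.lookup f m))"
  unfolding mpderiv_def
  by (rule sum.mono_neutral_left) (use assms in \<open>auto simp: in_keys_iff\<close>)

lemma mpderiv_single: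
  "mpderiv i (Poly_Mapping.single m c) =
    Poly_Mapping.single (m - Poly_Mapping.single i 1) (of_nat (Poly_Mapping.lookup m i) * c)"
  by (subst mpderiv_superset[of "{m}"]) auto

lemma mpderiv_add: "mpderiv i (f + g) = mpderiv i f + mpderiv i g"
proof -
  let ?A = "Poly_Mapping.keys f \<union> Poly_Mapping.keys g"
  have "finite ?A" "Poly_Mapping.keys (f + g) \<subseteq> ?A" "Poly_Mapping.keys f \<subseteq> ?A" "Poly_Mapping.keys g \<subseteq> ?A"
    using Poly_Mapping.keys_add[of f g] by auto
  from this(2-4)[THEN mpderiv_superset[OF this(1)]] show ?thesis
    by (simp add: lookup_add distrib_left single_add sum.distrib)
qed

lemma mpderiv_0 [simp]: "mpderiv i 0 = 0"
  by (simp add: mpderiv_def)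

lemma mpderiv_diff: "mpderiv i (f - g) = mpderiv i f - mpderiv i g"
  using mpderiv_add[of i "f - g" g] by simp

lemma mpderiv_sum: "mpderiv i (\<Sum>j\<in>A. f j) = (\<Sum>j\<in>A. mpderiv i (f j))"
  by (induction A rule: infinite_finite_induct) (auto simp: mpderiv_add)

lemma mpderiv_mult: "mpderiv i (f * g) = mpderiv i f * g + f * mpderiv i g"
proof -
  have shift: "Poly_Mapping.single (m + m' - Poly_Mapping.single i 1) (of_nat (Poly_Mapping.lookup m i) * c)
    = Poly_Mapping.single (m - Poly_Mapping.single i 1 + m') (of_nat (Poly_Mapping.lookup m i) * c)"
    for m m' :: "'a \<Rightarrow>\<^sub>0 nat" and c :: 'b
  proof (cases "Poly_Mapping.lookup m i = 0")
    case False
    have "m + m' - Poly_Mapping.single i 1 = m - Poly_Mapping.single i 1 + m'"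
      by (rule poly_mapping_eqI) (use False in \<open>auto simp: lookup_add lookup_minus lookup_single when_def\<close>)
    then show ?thesis by simp
  qed simp
  have single: "mpderiv i (Poly_Mapping.single m c * Poly_Mapping.single m' c') =
    mpderiv i (Poly_Mapping.single m c) * Poly_Mapping.single m' c'
    + Poly_Mapping.single m c * mpderiv i (Poly_Mapping.single m' c')"
    for m m' :: "'a \<Rightarrow>\<^sub>0 nat" and c c' :: 'b
    using shift[of m m' "c * c'"] shift[of m' m "c * c'"]
    by (simp add: mult_single mpderiv_single lookup_add distrib_right single_add algebra_simps)
  show ?thesis
  proof -
    have "mpderiv i ((\<Sum>m\<in>A. Poly_Mapping.single m (c m)) * (\<Sum>m\<in>B. Poly_Mapping.single m (c' m)))
      = mpderiv i (\<Sum>m\<in>A. Poly_Mapping.single m (c m)) * (\<Sum>m\<in>B. Poly_Mapping.single m (c' m))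
        + (\<Sum>m\<in>A. Poly_Mapping.single m (c m)) * mpderiv i (\<Sum>m\<in>B. Poly_Mapping.single m (c' m))"
      for A B :: "('a \<Rightarrow>\<^sub>0 nat) set" and c c' :: "('a \<Rightarrow>\<^sub>0 nat) \<Rightarrow> 'b"
      by (simp only: sum_product mpderiv_sum single sum.distrib)
    from this[where A = "Poly_Mapping.keys f" and c = "Poly_Mapping.lookup f"
        and B = "Poly_Mapping.keys g" and c' = "Poly_Mapping.lookup g"]
    show ?thesis by (simp only: flip: mpoly_eq_sum_single)
  qed
qed

lemma mpderiv_mvar: "mpderiv i (mvar j) = (if i = j then 1 else 0)"
  by (simp add: mvar_def mpderiv_single lookup_single when_def)

lemma mpderiv_mconst [simp]: "mpderiv i (mconst c) = 0"
  by (simp add: mconst_def mpderiv_single)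

section \<open>A parametrisation of the second surface\<close>

text \<open>With \<open>N = T\<^sup>2 + W\<^sup>2\<close>, \<open>D = T\<^sup>2 - W\<^sup>2\<close> and \<open>M = N - c D\<close>, at \<open>W = 1\<close> the equations of the second surface (for \<open>c = n\<close>)
  amount to \<open>2 x = M + v\<^sup>2 D\<close> and \<open>N M = D (u - t v) (u + t v)\<close>.  Given \<open>t = T\<close> and \<open>u - t v = A\<close>, the second
  determines \<open>u + t v\<close>, hence \<open>u\<close> and \<open>v\<close>, and the first determines \<open>x\<close>.  The tuple \<open>par\<close> is this point in
  homogeneous coordinates, cleared of denominators; its entries are forms of degree 8.  It is defined over any
  commutative ring so that it serves both as a tuple of polynomials and as a function on points.\<close>

fun par :: "'r::comm_ring_1 \<Rightarrow> 'r \<Rightarrow> 'r \<Rightarrow> 'r \<Rightarrow> coord' option \<Rightarrow> 'r" where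
  "par c T A W None = 8 * (T^2 - W^2) * A^2 * T^2 * W^2"
| "par c T A W (Some Dx) = 4 * (T^2 - W^2) * A^2 * T^2 * (T^2 + W^2 - c * (T^2 - W^2))
     + ((T^2 + W^2) * (T^2 + W^2 - c * (T^2 - W^2)) - (T^2 - W^2) * A^2)^2"
| "par c T A W (Some Dt) = 8 * (T^2 - W^2) * A^2 * T^3 * W"
| "par c T A W (Some Du) = 4 * A * T^2 * W
     * ((T^2 - W^2) * A^2 + (T^2 + W^2) * (T^2 + W^2 - c * (T^2 - W^2)))"
| "par c T A W (Some Dv) = 4 * A * T * W^2
     * ((T^2 + W^2) * (T^2 + W^2 - c * (T^2 - W^2)) - (T^2 - W^2) * A^2)"

lemma meval_par: "meval (par c T A W j) p = par (meval c p) (meval T p) (meval A p) (meval W p) j"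
proof (cases j)
  case (Some i)
  then show ?thesis by (cases i) simp_all
qed simp

lemma geom_par: "geom (par c T A W j) = par (geom c) (geom T) (geom A) (geom W) j"
proof (cases j)
  case (Some i)
  then show ?thesis by (cases i) simp_all
qed simp

lemma par_scale: "par c (m * T) (m * A) (m * W) j = m ^ 8 * par c T A W j"
proof (cases j)
  case None
  show ?thesis unfolding None par.simps by (simp add: algebra_simps eval_nat_numeral)
next
  case (Some i)
  show ?thesis unfolding Some by (cases i; simp only: par.simps; simp add: algebra_simps eval_nat_numeral)
qed

lemma homogeneous_par:
  fixes T A W :: "('v, 'k::field_char_0) mpoly"
  assumes "homogeneous 1 T" "homogeneous 1 A" "homogeneous 1 W"
  shows "homogeneous 8 (par (mconst c) T A W j)"
  using assms by (intro homogeneousI) (simp only: meval_par meval_homogeneous par_scale meval_mconst power_one_right)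

text \<open>The base-change projection \<open>X'_to_X\<close> for arbitrary ring elements in place of the variables.\<close>

fun toX :: "(coord' option \<Rightarrow> 'r::comm_ring_1) \<Rightarrow> coord \<Rightarrow> 'r" where
  "toX P Cx = P (Some Dx) * (P (Some Dt) ^ 2 - P None ^ 2)"
| "toX P Cy = P None * (P (Some Dt) ^ 2 + P None ^ 2)"
| "toX P Cu = P (Some Du) * (P (Some Dt) ^ 2 - P None ^ 2)"
| "toX P Cv = P (Some Dv) * (P (Some Dt) ^ 2 - P None ^ 2)"
| "toX P Cz = P None * (P (Some Dt) ^ 2 - P None ^ 2)"

lemma X'_to_X_eq: "X'_to_X j = toX mvar j"
  by (cases j) simp_all

lemma meval_toX: "meval (toX P j) p = toX (\<lambda>i. meval (P i) p) j"
  by (cases j) simp_all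

lemma geom_toX: "geom (toX P j) = toX (\<lambda>i. geom (P i)) j"
  by (cases j) simp_all

lemma toX_scale: "toX (\<lambda>i. m * P i) j = m ^ 3 * toX P j"
  by (cases j) (simp_all add: algebra_simps power2_eq_square power3_eq_cube)

lemma homogeneous_toX:
  fixes P :: "coord' option \<Rightarrow> ('v, 'k::field_char_0) mpoly"
  assumes "\<And>i. homogeneous d (P i)"
  shows "homogeneous (d * 3) (toX P j)"
  using assms by (intro homogeneousI) (simp only: meval_toX meval_homogeneous[OF assms] toX_scale power_mult)

lemma map_at_X'_to_X: "map_at X'_to_X p = toX p"
  by (rule ext) (simp add: map_at_def X'_to_X_eq geom_toX meval_toX)

text \<open>The affine part of the second surface and its ideal over the algebraic closure.\<close>

abbreviation affine_X' :: "rat \<Rightarrow> (coord' \<Rightarrow> rat alg_closure) set" where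
  "affine_X' n \<equiv> affine_zeros {geom (X'_eq1 n), geom (X'_eq2 n)}"

abbreviation ideal_X' :: "rat \<Rightarrow> (coord', rat alg_closure) mpoly set" where
  "ideal_X' n \<equiv> ideal2 (geom (X'_eq1 n)) (geom (X'_eq2 n))"

lemma mem_affine_X':
  "p \<in> affine_X' n \<longleftrightarrow>
     2 * p Dx = p Dt ^ 2 + 1 - to_ac n * (p Dt ^ 2 - 1) + p Dv ^ 2 * (p Dt ^ 2 - 1) \<and>
     (p Dt ^ 2 + 1) * (p Dt ^ 2 + 1 - to_ac n * (p Dt ^ 2 - 1))
       = (p Dt ^ 2 - 1) * (p Du ^ 2 - p Dt ^ 2 * p Dv ^ 2)"
proof -
  let ?x = "p Dx" and ?t = "p Dt" and ?u = "p Du" and ?v = "p Dv" and ?c = "to_ac n"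
  have "p \<in> affine_X' n \<longleftrightarrow>
    ?x * (?t^2 + 1) + ?x * (?t^2 - 1) + (?t^2 + 1) - ?c * (?t^2 - 1) - ?u^2 * (?t^2 - 1) = 0 \<and>
    ?x * (?t^2 + 1) - ?x * (?t^2 - 1) - (?t^2 + 1) + ?c * (?t^2 - 1) - ?v^2 * (?t^2 - 1) = 0"
    unfolding affine_zeros_def X'_eq1_def X'_eq2_def Let_def
    by (simp only: mem_Collect_eq ball_simps geom_add geom_diff geom_mult geom_power geom_1
        geom_mvar geom_mconst meval_add meval_diff meval_mult meval_power meval_1 meval_mvar
        meval_mconst simp_thms)
  also have "?x * (?t^2 + 1) - ?x * (?t^2 - 1) - (?t^2 + 1) + ?c * (?t^2 - 1) - ?v^2 * (?t^2 - 1)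
      = 2 * ?x - (?t ^ 2 + 1 - ?c * (?t ^ 2 - 1) + ?v ^ 2 * (?t ^ 2 - 1))" (is "_ = ?a")
    by (simp add: algebra_simps eval_nat_numeral)
  also have "?x * (?t^2 + 1) + ?x * (?t^2 - 1) + (?t^2 + 1) - ?c * (?t^2 - 1) - ?u^2 * (?t^2 - 1)
      = ?t ^ 2 * ?a + ((?t ^ 2 + 1) * (?t ^ 2 + 1 - ?c * (?t ^ 2 - 1))
        - (?t ^ 2 - 1) * (?u ^ 2 - ?t ^ 2 * ?v ^ 2))" (is "_ = ?t ^ 2 * ?a + ?b")
    by (simp add: algebra_simps eval_nat_numeral)
  also have "?t ^ 2 * ?a + ?b = 0 \<and> ?a = 0 \<longleftrightarrow> ?a = 0 \<and> ?b = 0"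
    by auto
  finally show ?thesis by simp
qed

lemma par_mem_affine_X':
  assumes "par (to_ac n) T A W None \<noteq> 0"
  shows "(\<lambda>i. par (to_ac n) T A W (Some i) / par (to_ac n) T A W None) \<in> affine_X' n"
proof -
  define D where "D = T^2 - W^2"
  define M where "M = T^2 + W^2 - to_ac n * D"
  define R where "R = (T^2 + W^2) * M"
  have nz: "T \<noteq> 0" "A \<noteq> 0" "W \<noteq> 0" "D \<noteq> 0" "(8::rat alg_closure) \<noteq> 0"
    using assms by (auto simp: D_def)
  let ?w = "8 * D * A^2 * T^2 * W^2"
  let ?p = "\<lambda>i. par (to_ac n) T A W (Some i) / par (to_ac n) T A W None"
  have t: "?p Dt = T / W"
    using nz unfolding par.simps D_def[symmetric] by (simp add: divide_simps eval_nat_numeral)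
  have u: "?p Du = (D * A^2 + R) / (2 * D * A * W)"
    using nz unfolding par.simps D_def[symmetric] M_def[symmetric] R_def[symmetric]
    by (simp add: divide_simps eval_nat_numeral)
  have v: "?p Dv = (R - D * A^2) / (2 * D * A * T)"
    using nz unfolding par.simps D_def[symmetric] M_def[symmetric] R_def[symmetric]
    by (simp add: divide_simps eval_nat_numeral)
  define E where "E = R - D * A^2"
  define K where "K = 4 * D * A^2 * T^2"
  have "K \<noteq> 0" using nz by (simp add: K_def)
  have "?p Dx = (K * M + E^2) / (K * (2 * W^2))"
    unfolding par.simps D_def[symmetric] M_def[symmetric] R_def[symmetric] E_def[symmetric] K_def
    by (simp add: mult_ac)
  then have x: "?p Dx = (M + E^2 / K) / (2 * W^2)"
    using \<open>K \<noteq> 0\<close> by (simp add: add_divide_distrib)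
  have D': "(T / W)^2 - 1 = D / W^2" and N': "(T / W)^2 + 1 = (T^2 + W^2) / W^2"
    using nz(3) by (simp_all add: D_def power_divide diff_divide_distrib add_divide_distrib)
  have M': "(T / W)^2 + 1 - to_ac n * ((T / W)^2 - 1) = M / W^2"
    unfolding D' N' by (simp add: M_def diff_divide_distrib)
  show ?thesis
    unfolding mem_affine_X' t u v x M'
    unfolding D' N'
  proof
    have "E^2 / K = (E / (2 * D * A * T))^2 * D"
      using nz by (simp add: K_def divide_simps power2_eq_square)
    then show "2 * ((M + E^2 / K) / (2 * W^2))
      = M / W^2 + ((R - D * A^2) / (2 * D * A * T))^2 * (D / W^2)"
      by (simp add: E_def[symmetric] add_divide_distrib)
    have "((D * A^2 + R) / (2 * D * A * W))^2 - (T / W)^2 * ((R - D * A^2) / (2 * D * A * T))^2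
      = ((D * A^2 + R)^2 - (R - D * A^2)^2) / (2 * D * A * W)^2"
    proof -
      have *: "(T / W)^2 * ((R - D * A^2) / (2 * D * A * T))^2 = ((R - D * A^2) / (2 * D * A * W))^2"
        unfolding power_mult_distrib[symmetric]
        by (rule arg_cong[where f = "\<lambda>z. z^2"]) (use nz in \<open>simp add: divide_simps\<close>)
      show ?thesis
        unfolding * by (simp only: power_divide flip: diff_divide_distrib)
    qed
    also have "(D * A^2 + R)^2 - (R - D * A^2)^2 = 4 * D * A^2 * R"
      by (simp add: algebra_simps eval_nat_numeral)
    also have "\<dots> / (2 * D * A * W)^2 = R / (D * W^2)"
      using nz by (simp add: divide_simps power2_eq_square)
    finally show "(T^2 + W^2) / W^2 * (M / W^2) = D / W^2 *
      (((D * A^2 + R) / (2 * D * A * W))^2 - (T / W)^2 * ((R - D * A^2) / (2 * D * A * T))^2)"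
      using nz by (simp add: R_def divide_simps power2_eq_square)
  qed
qed

text \<open>The tuple \<open>par\<close> reaches every affine point with \<open>t \<noteq> 0\<close> and \<open>u \<noteq> t v\<close>.\<close>

lemma par_inverse:
  assumes "p \<in> affine_X' n" "p Dt \<noteq> 0" "p Du \<noteq> p Dt * p Dv"
  defines "a \<equiv> p Du - p Dt * p Dv"
  shows "par (to_ac n) (p Dt) a 1 None \<noteq> 0"
    and "par (to_ac n) (p Dt) a 1 (Some i) = par (to_ac n) (p Dt) a 1 None * p i"
proof -
  let ?x = "p Dx" and ?t = "p Dt" and ?u = "p Du" and ?v = "p Dv" and ?c = "to_ac n"
  have x: "2 * ?x = ?t ^ 2 + 1 - ?c * (?t ^ 2 - 1) + ?v ^ 2 * (?t ^ 2 - 1)"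
    and q: "(?t ^ 2 + 1) * (?t ^ 2 + 1 - ?c * (?t ^ 2 - 1)) = (?t ^ 2 - 1) * (?u ^ 2 - ?t ^ 2 * ?v ^ 2)"
    using assms(1) by (simp_all only: mem_affine_X')
  have "?t ^ 2 - 1 \<noteq> 0"
    using assms(1) by (simp add: affine_X'_iff)
  then show "par ?c ?t a 1 None \<noteq> 0"
    using assms(2,3) by (simp add: a_def)
  have q': "(?t ^ 2 + 1 ^ 2) * (?t ^ 2 + 1 ^ 2 - ?c * (?t ^ 2 - 1 ^ 2)) = (?t ^ 2 - 1) * (a * (?u + ?t * ?v))"
    unfolding one_power2 q a_def by (simp add: algebra_simps eval_nat_numeral)
  have p: "(?t ^ 2 - 1) * a ^ 2 + (?t ^ 2 - 1) * (a * (?u + ?t * ?v)) = (?t ^ 2 - 1) * a * (2 * ?u)"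
    "(?t ^ 2 - 1) * (a * (?u + ?t * ?v)) - (?t ^ 2 - 1) * a ^ 2 = (?t ^ 2 - 1) * a * (2 * ?t * ?v)"
    by (simp_all add: a_def algebra_simps power2_eq_square)
  show "par ?c ?t a 1 (Some i) = par ?c ?t a 1 None * p i"
  proof (cases i)
    case Dx
    have "par ?c ?t a 1 (Some i) = 4 * (?t^2 - 1) * a^2 * ?t^2 * (?t^2 + 1 - ?c * (?t^2 - 1) + ?v ^ 2 * (?t ^ 2 - 1))"
      unfolding Dx par.simps q' unfolding one_power2 p by (simp add: algebra_simps eval_nat_numeral)
    then show ?thesis unfolding x[symmetric] by (simp add: Dx)
  next
    case Du
    show ?thesis unfolding Du par.simps q' unfolding one_power2 p by (simp add: algebra_simps eval_nat_numeral)
  next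
    case Dv
    show ?thesis unfolding Dv par.simps q' unfolding one_power2 p by (simp add: algebra_simps eval_nat_numeral)
  next
    case Dt
    show ?thesis unfolding Dt by (simp add: algebra_simps eval_nat_numeral)
  qed
qed

lemma ex_sqrt: "\<exists>s. s ^ 2 = (a :: 'a::alg_closed_field)"
  using nth_root_exists[of 2 a] by auto

lemma mconst_mult: "mconst a * mconst b = mconst (a * b)"
  by (simp add: mconst_def mult_single)

lemma mconst_numeral [simp]: "mconst (numeral k) = numeral k"
  by (simp add: mconst_def single_numeral)

lemma mconst_inverse: "(c :: 'k::field) \<noteq> 0 \<Longrightarrow> mconst (inverse c) * mconst c = 1"
  by (simp add: mconst_mult) (simp add: mconst_def)

lemma add_diff_eq_0_imp:
  fixes a b :: "'a::field_char_0"
  assumes "a + b = 0" "a - b = 0"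
  shows "a = 0 \<and> b = 0"
proof -
  have "2 * a = (a + b) + (a - b)" by simp
  then have "a = 0" unfolding assms by simp
  then show ?thesis using assms by simp
qed

lemma exists_avoiding: "\<exists>y \<in> {2, 3}. y \<noteq> (c :: 'a::field_char_0)"
  by (metis insertCI numeral_eq_iff semiring_norm(89))

text \<open>Modulo the ideal, \<open>x\<close> can be eliminated and, up to a power of \<open>D\<close>, what remains is \<open>a + b u\<close> with \<open>a\<close>, \<open>b\<close>
  polynomials in \<open>t\<close> and \<open>v\<close>.  Over a general \<open>(t, v)\<close> the surface has two points, with opposite values of \<open>u\<close>, so
  \<open>a = b = 0\<close>.  The power of \<open>D\<close> can be cancelled because \<open>N M \<equiv> 4\<close> modulo \<open>D\<close>, so that \<open>D\<close> is a unit modulo the ideal.\<close>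

lemma vanishing_on_affine_X'_generic_imp_mem_ideal:
  fixes h :: "(coord', rat alg_closure) mpoly"
  assumes "\<And>p. p \<in> affine_X' n \<Longrightarrow> p Dt \<noteq> 0 \<Longrightarrow> p Du \<noteq> p Dt * p Dv \<Longrightarrow> meval h p = 0"
  shows "h \<in> ideal_X' n"
proof -
  define t :: "(coord', rat alg_closure) mpoly" where "t = mvar Dt"
  define v :: "(coord', rat alg_closure) mpoly" where "v = mvar Dv"
  define u :: "(coord', rat alg_closure) mpoly" where "u = mvar Du"
  define x :: "(coord', rat alg_closure) mpoly" where "x = mvar Dx"
  define n' :: "(coord', rat alg_closure) mpoly" where "n' = mconst (to_ac n)"
  define N where "N = t^2 + 1"
  define D where "D = t^2 - 1"
  define M where "M = N - n' * D"
  note defs = t_def v_def u_def x_def n'_def N_def D_def M_def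
  have I1: "geom (X'_eq1 n) \<in> ideal_X' n" and I2: "geom (X'_eq2 n) \<in> ideal_X' n"
    unfolding ideal2_def by (force intro: exI[of _ 1] exI[of _ 0])+
  have e1: "geom (X'_eq1 n) = x * N + x * D + N - n' * D - u^2 * D"
    and e2: "geom (X'_eq2 n) = x * N - x * D - N + n' * D - v^2 * D"
    unfolding X'_eq1_def X'_eq2_def Let_def defs by simp_all
  have ND: "N = D + 2" and tD: "t^2 = D + 1" by (simp_all add: N_def D_def)
  have J1: "D * (u^2 - t^2 * v^2) - N * M \<in> ideal_X' n"
  proof -
    have "D * (u^2 - t^2 * v^2) - N * M = t^2 * geom (X'_eq2 n) + (- 1) * geom (X'_eq1 n)"
      unfolding e1 e2 M_def ND tD by (simp add: algebra_simps eval_nat_numeral)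
    then show ?thesis using I1 I2 ideal2_add ideal2_mult by metis
  qed
  define C where "C = mconst (inverse 2) * (M + v^2 * D)"
  have half: "mconst (inverse 2) * 2 = (1 :: (coord', rat alg_closure) mpoly)"
    using mconst_inverse[of "2 :: rat alg_closure"] by simp
  have J2: "x - C \<in> ideal_X' n"
  proof -
    have "x - C = (mconst (inverse 2) * 2) * x - C" unfolding half by simp
    also have "\<dots> = mconst (inverse 2) * (2 * x - (M + v^2 * D))"
      unfolding C_def right_diff_distrib mult.assoc ..
    also have "2 * x - (M + v^2 * D) = geom (X'_eq2 n)"
      unfolding e2 M_def ND by (simp add: algebra_simps)
    finally show ?thesis using I2 ideal2_mult by metis
  qed
  have freeC: "free_of {Dx} C" "free_of {Du, Dx} D" "free_of {Du, Dx} (D * t^2 * v^2 + N * M)"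
    unfolding C_def defs by (intro free_of_intros; simp)+
  obtain h1 where h1: "free_of {Dx} h1" "(x - C) dvd (h - h1)"
    using eliminate_linear[OF freeC(1)] unfolding x_def by blast
  obtain k a b where ab: "free_of {Du, Dx} a" "free_of {Du, Dx} b"
    "(D * u^2 - (D * t^2 * v^2 + N * M)) dvd (D ^ k * h1 - (a + b * u))"
    using eliminate_square[OF h1(1) _ freeC(3,2)] unfolding u_def by auto
  have "h - h1 \<in> ideal_X' n"
    using J2 h1(2) by (rule ideal2_dvd)
  moreover have "D ^ k * h1 - (a + b * u) \<in> ideal_X' n"
  proof (rule ideal2_dvd[OF J1])
    have "D * u^2 - (D * t^2 * v^2 + N * M) = D * (u^2 - t^2 * v^2) - N * M"
      by (simp add: algebra_simps)
    then show "D * (u^2 - t^2 * v^2) - N * M dvd D ^ k * h1 - (a + b * u)"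
      using ab(3) by (simp only:)
  qed
  moreover have "D ^ k * h - (a + b * u) = D ^ k * (h - h1) + (D ^ k * h1 - (a + b * u))"
    by (simp add: algebra_simps)
  ultimately have red: "D ^ k * h - (a + b * u) \<in> ideal_X' n"
    by (metis ideal2_add ideal2_mult)
  define G where "G = t * D * N * M"
  have vanish: "meval a p = 0 \<and> meval b p * meval (D * t^2 * v^2 + N * M) p = 0" if G: "meval G p \<noteq> 0" for p
  proof -
    let ?t = "p Dt" and ?v = "p Dv"
    let ?D = "?t^2 - 1" and ?N = "?t^2 + 1" and ?M = "?t^2 + 1 - to_ac n * (?t^2 - 1)"
    have nz: "?t \<noteq> 0" "?D \<noteq> 0" "?N \<noteq> 0" "?M \<noteq> 0"
      using G by (auto simp: G_def defs)
    obtain s where s: "s^2 = (?D * ?t^2 * ?v^2 + ?N * ?M) / ?D" using ex_sqrt by blast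
    have Ds: "?D * s^2 = ?D * ?t^2 * ?v^2 + ?N * ?M" unfolding s using nz by simp
    have *: "meval a p + meval b p * r = 0" if r: "r^2 = s^2" for r
    proof -
      define q where "q = p(Du := r, Dx := (?M + ?v^2 * ?D) / 2)"
      have q: "q Dt = ?t" "q Dv = ?v" "q Du = r" "q Dx = (?M + ?v^2 * ?D) / 2"
        by (simp_all add: q_def)
      have "q \<in> affine_X' n"
        unfolding mem_affine_X' q r using Ds by (simp add: algebra_simps)
      moreover have "r \<noteq> ?t * ?v"
      proof
        assume "r = ?t * ?v"
        then have "?N * ?M = 0" using Ds unfolding r[symmetric] by (simp add: algebra_simps)
        with nz show False by simp
      qed
      ultimately have "meval h q = 0" and qX: "q \<in> affine_X' n"
        using assms[of q] nz by (simp_all add: q)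
      have "meval (D ^ k * h - (a + b * u)) q = 0"
        by (rule meval_ideal2[OF red]) (use qX in \<open>auto simp: affine_zeros_def\<close>)
      then have "meval a q + meval b q * r = 0"
        using \<open>meval h q = 0\<close> by (simp add: u_def q add_eq_0_iff)
      moreover have "meval a q = meval a p" "meval b q = meval b p"
        by (rule meval_free_of[OF ab(1)], simp add: q_def) (rule meval_free_of[OF ab(2)], simp add: q_def)
      ultimately show ?thesis by simp
    qed
    have a: "meval a p = 0 \<and> meval b p * s = 0"
      using *[of s] *[of "- s"] by (intro add_diff_eq_0_imp) simp_all
    then have "meval b p * (?D * s^2) = 0" by auto
    then show ?thesis using a unfolding Ds by (simp add: defs)
  qed
  \<comment> \<open>At \<open>t = 2\<close> one has \<open>M = 5 - 3 n\<close>; if this vanishes, \<open>t = 3\<close> works.\<close>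
  obtain p0 where p0: "meval G p0 \<noteq> 0" "meval (D * t^2 * v^2 + N * M) p0 \<noteq> 0"
  proof (cases "to_ac n = (5/3 :: rat alg_closure)")
    case True
    show ?thesis
      by (rule that[of "\<lambda>i. if i = Dt then 3 else 0"]) (simp_all add: G_def defs True)
  next
    case False
    then have "3 * to_ac n \<noteq> (5 :: rat alg_closure)" by (simp add: field_simps)
    then have "5 - 3 * to_ac n \<noteq> (0 :: rat alg_closure)" by simp
    then show ?thesis
      by (intro that[of "\<lambda>i. if i = Dt then 2 else 0"]) (simp_all add: G_def defs algebra_simps)
  qed
  have "a = 0"
  proof (rule meval_eq_0_imp_eq_0)
    fix p show "meval a p = 0"
      by (rule irreducible_setD[OF irreducible_set_UNIV _ _ p0(1)]) (use vanish in auto)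
  qed
  have "b = 0"
  proof (rule meval_eq_0_imp_eq_0)
    fix p show "meval b p = 0"
    proof (rule irreducible_setD[OF irreducible_set_UNIV, where q = p0])
      show "meval b q = 0 \<or> meval (G * (D * t^2 * v^2 + N * M)) q = 0" for q
        using vanish[of q] by auto
      show "meval (G * (D * t^2 * v^2 + N * M)) p0 \<noteq> 0"
        unfolding meval_mult[of G] using p0 by simp
    qed auto
  qed
  \<comment> \<open>\<open>N = D + 2\<close> and \<open>M = 2 + (1 - n) D\<close>, whence \<open>N M = 4 + D (2 + 2 (1 - n) + (1 - n) D)\<close>\<close>
  have cancel: "g \<in> ideal_X' n" if "D * g \<in> ideal_X' n" for g
  proof -
    let ?E = "u^2 - t^2 * v^2 - 2 - 2 * (1 - n') - (1 - n') * D"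
    have "4 * g = ?E * (D * g) + (- g) * (D * (u^2 - t^2 * v^2) - N * M)"
      unfolding M_def ND by (simp add: algebra_simps eval_nat_numeral)
    then have "4 * g \<in> ideal_X' n"
      using that J1 by (metis ideal2_add ideal2_mult)
    moreover have "mconst (inverse 4) * 4 = (1 :: (coord', rat alg_closure) mpoly)"
      using mconst_inverse[of "4 :: rat alg_closure"] by simp
    then have "g = mconst (inverse 4) * (4 * g)"
      by (simp only: mult_1_left flip: mult.assoc)
    ultimately show ?thesis by (metis ideal2_mult)
  qed
  have "D ^ k * h \<in> ideal_X' n"
    using red \<open>a = 0\<close> \<open>b = 0\<close> by simp
  then show ?thesis
  proof (induction k)
    case (Suc k)
    have "D * (D ^ k * h) \<in> ideal_X' n"
      using Suc.prems by (simp add: mult.assoc)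
    then show ?case by (rule Suc.IH[OF cancel])
  qed simp
qed

section \<open>Irreducibility of the two surfaces\<close>

text \<open>In the next two lemmas \<open>S\<close> is a set of zeros of \<open>f\<close>, \<open>g\<close> that is large enough for every polynomial vanishing on
  it to lie in the ideal \<open>(f, g)\<close>.\<close>

lemma is_prime_ideal_if_irreducible_zeros:
  assumes "irreducible_set S" "p0 \<in> S" "\<And>p. p \<in> S \<Longrightarrow> meval f p = 0 \<and> meval g p = 0"
    and "\<And>h. (\<And>p. p \<in> S \<Longrightarrow> meval h p = 0) \<Longrightarrow> h \<in> ideal2 f g"
  shows "is_prime_ideal (ideal2 f g)"
  unfolding is_prime_ideal_def
proof (intro conjI allI impI notI)
  assume "1 \<in> ideal2 f g"
  then have "meval 1 p0 = 0"
    by (rule meval_ideal2) (use assms(2,3) in auto)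
  then show False by simp
next
  fix a b assume "a * b \<in> ideal2 f g"
  then have "meval a p * meval b p = 0" if "p \<in> S" for p
    using meval_ideal2[of "a * b" f g p] assms(3) that by simp
  then have "(\<forall>p\<in>S. meval a p = 0) \<or> (\<forall>p\<in>S. meval b p = 0)"
    using assms(1) by (auto simp: irreducible_set_def)
  then show "a \<in> ideal2 f g \<or> b \<in> ideal2 f g"
    using assms(4) by blast
qed

lemma irreducible_set_zeros:
  assumes "irreducible_set S" "S \<subseteq> Z" "\<And>p. p \<in> Z \<Longrightarrow> meval f p = 0 \<and> meval g p = 0"
    and "\<And>h. (\<And>p. p \<in> S \<Longrightarrow> meval h p = 0) \<Longrightarrow> h \<in> ideal2 f g"
  shows "irreducible_set Z"
  unfolding irreducible_set_def
proof (intro allI impI)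
  fix a b assume "\<forall>p\<in>Z. meval a p * meval b p = 0"
  then have "(\<forall>p\<in>S. meval a p = 0) \<or> (\<forall>p\<in>S. meval b p = 0)"
    using assms(1,2) unfolding irreducible_set_def by blast
  then have "a \<in> ideal2 f g \<or> b \<in> ideal2 f g"
    using assms(4) by blast
  then show "(\<forall>p\<in>Z. meval a p = 0) \<or> (\<forall>p\<in>Z. meval b p = 0)"
    using assms(3) meval_ideal2 by blast
qed

text \<open>The parametrisation as a map on geometric points with coordinates \<open>(T : A : W)\<close>, and as a tuple of
  polynomials over the rationals.\<close>

definition par_at :: "rat \<Rightarrow> (3 \<Rightarrow> rat alg_closure) \<Rightarrow> coord' option \<Rightarrow> rat alg_closure" where
  "par_at n q = par (to_ac n) (q 0) (q 1) (q 2)"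

definition par_poly :: "rat \<Rightarrow> coord' option \<Rightarrow> (3, rat) mpoly" where
  "par_poly n = par (mconst n) (mvar 0) (mvar 1) (mvar 2)"

lemma meval_par_poly: "meval (geom (par_poly n j)) q = par_at n q j"
  by (simp add: par_poly_def par_at_def geom_par meval_par)

lemma map_at_par_poly: "map_at (par_poly n) q = par_at n q"
  by (rule ext) (simp add: map_at_def meval_par_poly)

lemma par_at_None: "par_at n q None = 8 * (q 0 ^ 2 - q 2 ^ 2) * q 1 ^ 2 * q 0 ^ 2 * q 2 ^ 2"
  by (simp add: par_at_def)

lemma homogeneous_par_poly: "homogeneous 8 (par_poly n j)"
  unfolding par_poly_def by (intro homogeneous_par homogeneous_mvar)

lemma par_at_scale: "par_at n (\<lambda>i. m * q i) j = m ^ 8 * par_at n q j"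
  by (simp add: par_at_def par_scale)

lemma par_mem_surface_X':
  assumes "par (to_ac n) T A W None \<noteq> 0"
  shows "par (to_ac n) T A W \<in> surface_X' n"
  using assms par_mem_affine_X'[OF assms]
  by (simp only: surface_X'_def of_affine_def mem_Collect_eq simp_thms)

lemma par_at_mem_surface_X':
  "par_at n q None \<noteq> 0 \<Longrightarrow> par_at n q \<in> surface_X' n"
  unfolding par_at_def by (rule par_mem_surface_X')

lemma par_at_nonzero: "par_at n (\<lambda>i. if i = 0 then 2 else 1) None \<noteq> 0"
  by (simp add: par_at_None)

text \<open>The affine points of the second surface reached by the parametrisation.\<close>

definition param_X' :: "rat \<Rightarrow> (coord' \<Rightarrow> rat alg_closure) set" where
  "param_X' n = {\<lambda>i. par_at n q (Some i) / par_at n q None | q. par_at n q None \<noteq> 0}"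

lemma irreducible_param_X': "irreducible_set (param_X' n)"
  unfolding param_X'_def meval_par_poly[symmetric] by (rule irreducible_set_parametrised)

lemma param_X'_subset: "param_X' n \<subseteq> affine_X' n"
  using par_mem_affine_X' by (auto simp only: param_X'_def par_at_def)

lemma param_X'_nonempty: "param_X' n \<noteq> {}"
  using par_at_nonzero by (auto simp: param_X'_def)

lemma generic_affine_X'_eq_par_at:
  assumes "p \<in> affine_X' n" "p Dt \<noteq> 0" "p Du \<noteq> p Dt * p Dv"
  shows "\<exists>q. par_at n q None \<noteq> 0 \<and> (\<forall>i. par_at n q (Some i) = par_at n q None * p i)"
  using par_inverse[OF assms]
  by (intro exI[of _ "\<lambda>i. if i = 0 then p Dt else if i = 1 then p Du - p Dt * p Dv else 1"])
    (simp only: par_at_def, simp)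

lemma vanishing_on_param_X'_imp_mem_ideal:
  assumes "\<And>p. p \<in> param_X' n \<Longrightarrow> meval h p = 0"
  shows "h \<in> ideal_X' n"
proof (rule vanishing_on_affine_X'_generic_imp_mem_ideal)
  fix p assume "p \<in> affine_X' n" "p Dt \<noteq> 0" "p Du \<noteq> p Dt * p Dv"
  then obtain q where q: "par_at n q None \<noteq> 0" "\<And>i. par_at n q (Some i) = par_at n q None * p i"
    using generic_affine_X'_eq_par_at by blast
  then have "p = (\<lambda>i. par_at n q (Some i) / par_at n q None)" by simp
  with q(1) have "p \<in> param_X' n" unfolding param_X'_def by blast
  then show "meval h p = 0" by (rule assms)
qed

lemma geometrically_integral_X': "geometrically_integral (X'_eq1 n) (X'_eq2 n)"
proof -
  obtain p0 where "p0 \<in> param_X' n" using param_X'_nonempty by auto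
  then show ?thesis
    unfolding geometrically_integral_def
  proof (rule is_prime_ideal_if_irreducible_zeros[OF irreducible_param_X'])
    show "h \<in> ideal_X' n" if "\<And>p. p \<in> param_X' n \<Longrightarrow> meval h p = 0" for h
      using that by (rule vanishing_on_param_X'_imp_mem_ideal)
  qed (use param_X'_subset in \<open>auto simp: affine_zeros_def\<close>)
qed

lemma irreducible_cone_X': "irreducible_cone (surface_X' n)"
  unfolding surface_X'_def
proof (rule irreducible_cone_of_affine, rule irreducible_set_zeros[OF irreducible_param_X' param_X'_subset])
  show "h \<in> ideal_X' n" if "\<And>p. p \<in> param_X' n \<Longrightarrow> meval h p = 0" for h
    using that by (rule vanishing_on_param_X'_imp_mem_ideal)
qed (simp add: affine_zeros_def)

text \<open>The homogeneous ideal of the first surface over the algebraic closure.\<close>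

abbreviation ideal_X :: "rat \<Rightarrow> (coord, rat alg_closure) mpoly set" where
  "ideal_X n \<equiv> ideal2 (geom (X_eq1 n)) (geom (X_eq2 n))"

lemma meval_X_eq1: "meval (geom (X_eq1 n)) p =
    p Cx * p Cy + p Cx * p Cz + p Cy * p Cz - to_ac n * p Cz ^ 2 - p Cu ^ 2"
  by (simp add: X_eq1_def Let_def)

lemma meval_X_eq2: "meval (geom (X_eq2 n)) p =
    p Cx * p Cy - p Cx * p Cz - p Cy * p Cz + to_ac n * p Cz ^ 2 - p Cv ^ 2"
  by (simp add: X_eq2_def Let_def)

text \<open>A form whose nonvanishing locus on the first surface lies in the image of the parametrisation: at
  \<open>y = (t\<^sup>2 + 1) / (t\<^sup>2 - 1)\<close> its factors exclude \<open>z = 0\<close>, \<open>N = 0\<close>, \<open>t = \<infinity>\<close>, \<open>t = 0\<close> and \<open>M = 0\<close>.\<close>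

definition generic_X :: "rat \<Rightarrow> (coord, rat alg_closure) mpoly" where
  "generic_X n = mvar Cz * mvar Cy * (mvar Cy - mvar Cz) * (mvar Cy + mvar Cz)
     * (mvar Cy - mconst (to_ac n) * mvar Cz)"

text \<open>As the composite parametrisation is homogeneous of degree 24, a 24th root adjusts the scalar, so that the point is
  reached as a vector and not only up to proportionality.\<close>

lemma generic_X_eq_toX_par_at:
  assumes eqs: "meval (geom (X_eq1 n)) p = 0" "meval (geom (X_eq2 n)) p = 0"
    and "meval (generic_X n) p \<noteq> 0"
  shows "\<exists>q. par_at n q None \<noteq> 0 \<and> toX (par_at n q) = p"
proof -
  let ?x = "p Cx" and ?y = "p Cy" and ?u = "p Cu" and ?v = "p Cv" and ?z = "p Cz" and ?c = "to_ac n"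
  have nz: "?z \<noteq> 0" "?y \<noteq> 0" "?y - ?z \<noteq> 0" "?y + ?z \<noteq> 0" "?y - ?c * ?z \<noteq> 0"
    using assms(3) by (auto simp: generic_X_def)
  obtain t where t: "t ^ 2 = (?y + ?z) / (?y - ?z)" using ex_sqrt by blast
  have D: "t ^ 2 - 1 = 2 * ?z / (?y - ?z)" and N: "t ^ 2 + 1 = 2 * ?y / (?y - ?z)"
    unfolding t using nz(3) by (simp_all add: divide_simps)
  define p' where "p' i = (case i of Dx \<Rightarrow> ?x / ?z | Dt \<Rightarrow> t | Du \<Rightarrow> ?u / ?z | Dv \<Rightarrow> ?v / ?z)" for i
  have p': "p' Dx = ?x / ?z" "p' Dt = t" "p' Du = ?u / ?z" "p' Dv = ?v / ?z"
    by (simp_all add: p'_def)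
  have y: "(t ^ 2 + 1) / (t ^ 2 - 1) = ?y / ?z"
    unfolding D N using nz by (simp add: divide_simps)
  have t1: "t ^ 2 - 1 \<noteq> 0" unfolding D using nz by simp
  have u: "?u ^ 2 = ?x * ?y + ?x * ?z + ?y * ?z - ?c * ?z ^ 2"
    and v: "?v ^ 2 = ?x * ?y - ?x * ?z - ?y * ?z + ?c * ?z ^ 2"
    using eqs by (simp_all only: meval_X_eq1 meval_X_eq2 right_minus_eq)
  have X': "p' \<in> affine_X' n"
    unfolding affine_X'_iff p' y power_divide u v
    using t1 nz(1) by (simp add: add_divide_distrib diff_divide_distrib power2_eq_square)
  moreover have "p' Dt \<noteq> 0"
  proof
    assume "p' Dt = 0"
    then have "(?y + ?z) / (?y - ?z) = 0" unfolding t[symmetric] p' by simp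
    then show False using nz by simp
  qed
  moreover have "p' Du \<noteq> p' Dt * p' Dv"
  proof
    assume *: "p' Du = p' Dt * p' Dv"
    have "(t ^ 2 + 1) * (t ^ 2 + 1 - ?c * (t ^ 2 - 1)) = (t ^ 2 - 1) * (p' Du ^ 2 - t ^ 2 * p' Dv ^ 2)"
      using X' unfolding mem_affine_X' p'(2) by blast
    also have "\<dots> = 0" unfolding * p'(2) by (simp add: power_mult_distrib)
    finally have "2 * ?y / (?y - ?z) * (2 * (?y - ?c * ?z) / (?y - ?z)) = 0"
      unfolding D N by (simp add: diff_divide_distrib algebra_simps)
    then show False using nz by simp
  qed
  ultimately obtain q where q: "par_at n q None \<noteq> 0" "\<And>i. par_at n q (Some i) = par_at n q None * p' i"
    using generic_affine_X'_eq_par_at by blast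
  define w where "w = par_at n q None"
  have w: "w \<noteq> 0" using q(1) by (simp add: w_def)
  define e where "e = w ^ 3 * (t ^ 2 - 1) / ?z"
  have e: "e \<noteq> 0" unfolding e_def using w t1 nz by simp
  have toX: "toX (par_at n q) j = e * p j" for j
  proof -
    have "par_at n q = (\<lambda>i. w * case_option 1 p' i)"
      by (auto simp: fun_eq_iff w_def q(2) split: option.split)
    then have "toX (par_at n q) j = w ^ 3 * toX (case_option 1 p') j"
      by (simp only: toX_scale)
    also have "toX (case_option 1 p') j = (t ^ 2 - 1) * (p j / ?z)"
      using nz(1) y t1 by (cases j) (simp_all add: p' field_simps)
    finally show ?thesis by (simp add: e_def)
  qed
  obtain m where m: "m ^ 24 = inverse e"
    using nth_root_exists[of 24 "inverse e"] by auto
  have "m \<noteq> 0" using m e by (auto simp: power_0_left)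
  have "toX (par_at n (\<lambda>i. m * q i)) j = p j" for j
  proof -
    have "toX (par_at n (\<lambda>i. m * q i)) j = toX (\<lambda>i. m ^ 8 * par_at n q i) j"
      by (rule arg_cong[where f = "\<lambda>P. toX P j"]) (simp add: fun_eq_iff par_at_scale)
    also have "\<dots> = m ^ 24 * (e * p j)"
      by (simp only: toX_scale toX flip: power_mult) simp
    finally show ?thesis unfolding m using e by simp
  qed
  then show ?thesis
    using q(1) \<open>m \<noteq> 0\<close> by (intro exI[of _ "\<lambda>i. m * q i"]) (simp add: par_at_scale fun_eq_iff)
qed

text \<open>The equations are \<open>u\<^sup>2 = A\<close> and \<open>v\<^sup>2 = B\<close> with \<open>A\<close>, \<open>B\<close> in \<open>x\<close>, \<open>y\<close>, \<open>z\<close>, so modulo the ideal every polynomial is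
  \<open>a0 + a1 v + (b0 + b1 v) u\<close> with coefficients in \<open>x\<close>, \<open>y\<close>, \<open>z\<close>.  The four choices of signs of \<open>u\<close> and \<open>v\<close> over a
  general \<open>(x, y, z)\<close> show that the coefficients vanish.\<close>

lemma vanishing_on_generic_X_imp_mem_ideal:
  fixes h :: "(coord, rat alg_closure) mpoly"
  assumes "\<And>p. meval (geom (X_eq1 n)) p = 0 \<Longrightarrow> meval (geom (X_eq2 n)) p = 0
    \<Longrightarrow> meval (generic_X n) p \<noteq> 0 \<Longrightarrow> meval h p = 0"
  shows "h \<in> ideal_X n"
proof -
  define u :: "(coord, rat alg_closure) mpoly" where "u = mvar Cu"
  define v :: "(coord, rat alg_closure) mpoly" where "v = mvar Cv"
  define A :: "(coord, rat alg_closure) mpoly" where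
    "A = mvar Cx * mvar Cy + mvar Cx * mvar Cz + mvar Cy * mvar Cz - mconst (to_ac n) * mvar Cz ^ 2"
  define B :: "(coord, rat alg_closure) mpoly" where
    "B = mvar Cx * mvar Cy - mvar Cx * mvar Cz - mvar Cy * mvar Cz + mconst (to_ac n) * mvar Cz ^ 2"
  have e1: "geom (X_eq1 n) = A - u^2" and e2: "geom (X_eq2 n) = B - v^2"
    by (simp_all add: X_eq1_def X_eq2_def Let_def A_def B_def u_def v_def)
  have I1: "geom (X_eq1 n) \<in> ideal_X n" and I2: "geom (X_eq2 n) \<in> ideal_X n"
    unfolding ideal2_def by (force intro: exI[of _ 1] exI[of _ 0])+
  have "(- 1) * geom (X_eq1 n) \<in> ideal_X n" "(- 1) * geom (X_eq2 n) \<in> ideal_X n"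
    using I1 I2 by (blast intro: ideal2_mult)+
  then have J1: "1 * u^2 - A \<in> ideal_X n" and J2: "1 * v^2 - B \<in> ideal_X n"
    unfolding e1 e2 by simp_all
  have free: "free_of {Cu} A" "free_of {Cv, Cu} B"
    unfolding A_def B_def by (intro free_of_intros; simp)+
  obtain a b where ab: "free_of {Cu} a" "free_of {Cu} b" "(1 * u^2 - A) dvd (h - (a + b * u))"
    using eliminate_square[of "{}" h Cu A 1] free(1) unfolding u_def by auto
  have split: "\<exists>a0 a1. free_of {Cv, Cu} a0 \<and> free_of {Cv, Cu} a1 \<and> (1 * v^2 - B) dvd (a - (a0 + a1 * v))"
    if "free_of {Cu} a" for a
    using eliminate_square[OF that _ free(2), of 1] unfolding v_def by auto
  obtain a0 a1 where a01: "free_of {Cv, Cu} a0" "free_of {Cv, Cu} a1" "(1 * v^2 - B) dvd (a - (a0 + a1 * v))"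
    using split[OF ab(1)] by blast
  obtain b0 b1 where b01: "free_of {Cv, Cu} b0" "free_of {Cv, Cu} b1" "(1 * v^2 - B) dvd (b - (b0 + b1 * v))"
    using split[OF ab(2)] by blast
  have red: "h - (a0 + a1 * v + (b0 + b1 * v) * u) \<in> ideal_X n"
  proof -
    have "h - (a + b * u) \<in> ideal_X n" "a - (a0 + a1 * v) \<in> ideal_X n" "b - (b0 + b1 * v) \<in> ideal_X n"
      using ideal2_dvd[OF J1 ab(3)] ideal2_dvd[OF J2 a01(3)] ideal2_dvd[OF J2 b01(3)] by auto
    moreover have "h - (a0 + a1 * v + (b0 + b1 * v) * u)
      = (h - (a + b * u)) + ((a - (a0 + a1 * v)) + u * (b - (b0 + b1 * v)))"
      by (simp add: algebra_simps)
    ultimately show ?thesis by (metis ideal2_add ideal2_mult)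
  qed
  have vanish: "meval a0 p = 0 \<and> meval (a1 * B) p = 0 \<and> meval (b0 * A) p = 0 \<and> meval (b1 * (A * B)) p = 0"
    if G: "meval (generic_X n) p \<noteq> 0" for p
  proof -
    obtain r where r: "r ^ 2 = meval A p" using ex_sqrt by blast
    obtain s where s: "s ^ 2 = meval B p" using ex_sqrt by blast
    have *: "meval a0 p + meval a1 p * s' + (meval b0 p + meval b1 p * s') * r' = 0"
      if r': "r' ^ 2 = r ^ 2" and s': "s' ^ 2 = s ^ 2" for r' s'
    proof -
      define q where "q = p(Cu := r', Cv := s')"
      have q0: "q Cu = r'" "q Cv = s'" by (simp_all add: q_def)
      have q: "meval f q = meval f p" if "free_of {Cv, Cu} f" for f
        by (rule meval_free_of[OF that]) (simp add: q_def)
      have qA: "meval A q = meval A p" and qB: "meval B q = meval B p"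
        and qG: "meval (generic_X n) q = meval (generic_X n) p"
        by (simp_all add: A_def B_def generic_X_def q_def)
      have 1: "meval (geom (X_eq1 n)) q = 0" and 2: "meval (geom (X_eq2 n)) q = 0"
        by (simp_all add: e1 e2 qA qB u_def v_def q0 r' s' r s)
      then have "meval h q = 0" using assms[of q] G qG by simp
      then have "meval (h - (a0 + a1 * v + (b0 + b1 * v) * u)) q
          = - (meval a0 p + meval a1 p * s' + (meval b0 p + meval b1 p * s') * r')"
        using q a01(1,2) b01(1,2) by (simp add: u_def v_def q0)
      then show ?thesis
        using meval_ideal2[OF red 1 2] by (metis neg_equal_0_iff_equal)
    qed
    have 1: "meval a0 p + meval a1 p * s' = 0 \<and> (meval b0 p + meval b1 p * s') * r = 0"
      if "s' ^ 2 = s ^ 2" for s'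
      using *[of r s'] *[of "- r" s'] that by (intro add_diff_eq_0_imp) simp_all
    have "meval a0 p = 0 \<and> meval a1 p * s = 0"
      using 1[of s] 1[of "- s"] by (intro add_diff_eq_0_imp) simp_all
    moreover have "meval b0 p * r = 0 \<and> meval b1 p * s * r = 0"
      using 1[of s] 1[of "- s"] by (intro add_diff_eq_0_imp) (simp_all add: algebra_simps)
    ultimately have "meval a0 p = 0" "meval a1 p * s = 0" "meval b0 p * r = 0" "meval b1 p * (r * s) = 0"
      by auto
    then show ?thesis by (auto simp flip: r s)
  qed
  obtain y :: "rat alg_closure" where y: "y \<in> {2, 3}" "y \<noteq> to_ac n"
    using exists_avoiding by blast
  define p0 where "p0 i = (if i = Cy then y else if i = Cz then 1 else 0)" for i
  have G: "meval (generic_X n) p0 \<noteq> 0" and AB: "meval (A * B) p0 \<noteq> 0"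
    using y by (auto simp: generic_X_def p0_def A_def B_def)
  have zero: "f = 0" if "\<And>p. meval (generic_X n) p \<noteq> 0 \<Longrightarrow> meval (f * g) p = 0" "meval g p0 \<noteq> 0" for f g
  proof (rule meval_eq_0_imp_eq_0)
    fix p show "meval f p = 0"
    proof (rule irreducible_setD[OF irreducible_set_UNIV, where q = p0])
      show "meval f q = 0 \<or> meval (g * generic_X n) q = 0" for q
        using that(1)[of q] by auto
      show "meval (g * generic_X n) p0 \<noteq> 0"
        unfolding meval_mult using that(2) G by simp
    qed auto
  qed
  have "a0 = 0" using zero[of a0 1] vanish by simp
  moreover have "a1 = 0" using zero[of a1 B] vanish AB by simp
  moreover have "b0 = 0" using zero[of b0 A] vanish AB by simp
  moreover have "b1 = 0" using zero[of b1 "A * B"] vanish AB by blast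
  ultimately show ?thesis using red by simp
qed

text \<open>The resulting rational map from the plane to the first surface.\<close>

definition X_poly :: "rat \<Rightarrow> coord \<Rightarrow> (3, rat) mpoly" where
  "X_poly n = toX (par_poly n)"

lemma meval_X_poly: "meval (geom (X_poly n j)) q = toX (par_at n q) j"
  by (simp add: X_poly_def geom_toX meval_toX meval_par_poly)

lemma map_at_X_poly: "map_at (X_poly n) q = toX (par_at n q)"
  by (rule ext) (simp add: map_at_def meval_X_poly)

lemma homogeneous_X_poly: "homogeneous 24 (X_poly n j)"
  using homogeneous_toX[of 8 "par_poly n" j] by (simp add: X_poly_def homogeneous_par_poly)

text \<open>The part of the cone over the first surface that the parametrisation reaches.\<close>

definition param_X :: "rat \<Rightarrow> (coord \<Rightarrow> rat alg_closure) set" where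
  "param_X n = {toX (par_at n q) | q. par_at n q None \<noteq> 0}"

lemma irreducible_param_X: "irreducible_set (param_X n)"
proof -
  have "param_X n = {\<lambda>j. meval (geom (X_poly n j) * geom (par_poly n None)) q
      / meval (geom (par_poly n None)) q | q. meval (geom (par_poly n None)) q \<noteq> 0}"
    unfolding param_X_def meval_mult meval_X_poly meval_par_poly by (intro Collect_cong ex_cong1) auto
  then show ?thesis by (simp only: irreducible_set_parametrised)
qed

lemma toX_par_at_mem_surface_X: "par_at n q None \<noteq> 0 \<Longrightarrow> toX (par_at n q) \<in> surface_X n"
  using base_change_square(1)[OF par_at_mem_surface_X'] by (simp add: map_at_X'_to_X)

lemma param_X_subset: "param_X n \<subseteq> surface_X n"
  using toX_par_at_mem_surface_X by (auto simp: param_X_def)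

lemma vanishing_on_param_X_imp_mem_ideal:
  assumes "\<And>p. p \<in> param_X n \<Longrightarrow> meval h p = 0"
  shows "h \<in> ideal_X n"
proof (rule vanishing_on_generic_X_imp_mem_ideal)
  fix p assume "meval (geom (X_eq1 n)) p = 0" "meval (geom (X_eq2 n)) p = 0" "meval (generic_X n) p \<noteq> 0"
  then have "p \<in> param_X n"
    using generic_X_eq_toX_par_at unfolding param_X_def by blast
  then show "meval h p = 0" by (rule assms)
qed

lemma surface_X_zeros: "p \<in> surface_X n \<Longrightarrow> meval (geom (X_eq1 n)) p = 0 \<and> meval (geom (X_eq2 n)) p = 0"
  by (simp add: surface_X_def proj_zeros_def)

lemma geometrically_integral_X: "geometrically_integral (X_eq1 n) (X_eq2 n)"
proof -
  have "toX (par_at n (\<lambda>i. if i = 0 then 2 else 1)) \<in> param_X n"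
    using par_at_nonzero unfolding param_X_def by blast
  then show ?thesis
    unfolding geometrically_integral_def
  proof (rule is_prime_ideal_if_irreducible_zeros[OF irreducible_param_X])
    show "h \<in> ideal_X n" if "\<And>p. p \<in> param_X n \<Longrightarrow> meval h p = 0" for h
      using that by (rule vanishing_on_param_X_imp_mem_ideal)
  qed (use param_X_subset surface_X_zeros in blast)+
qed

lemma irreducible_cone_X: "irreducible_cone (surface_X n)"
proof (rule irreducible_set_imp_cone, rule irreducible_set_zeros[OF irreducible_param_X param_X_subset])
  show "h \<in> ideal_X n" if "\<And>p. p \<in> param_X n \<Longrightarrow> meval h p = 0" for h
    using that by (rule vanishing_on_param_X_imp_mem_ideal)
qed (rule surface_X_zeros)

section \<open>Smoothness and the del Pezzo property\<close>

lemma to_ac_neqs: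
  assumes "n \<notin> {0, 1, -1}"
  shows "to_ac n \<noteq> 0" "to_ac n \<noteq> 1" "to_ac n \<noteq> -1"
  using assms by (auto simp flip: to_ac_1 to_ac_minus)

text \<open>With \<open>\<alpha> = a + b\<close> and \<open>\<beta> = b - a\<close>, a singular point satisfies \<open>\<alpha> x = \<alpha> y = \<beta> z\<close>, \<open>\<beta> (x + y - 2 n z) = 0\<close> and
  \<open>a u = b v = 0\<close>.  The main case is \<open>x = y = n z\<close> with \<open>z \<noteq> 0\<close>, where \<open>u\<^sup>2 = n (n + 1) z\<^sup>2\<close> and
  \<open>v\<^sup>2 = n (n - 1) z\<^sup>2\<close>; this is where \<open>n \<noteq> 0, 1, -1\<close> is needed.\<close>

lemma smooth_X:
  assumes "n \<notin> {0, 1, -1}"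
  shows "smooth_codim2 (X_eq1 n) (X_eq2 n)"
  unfolding smooth_codim2_def
proof (intro ballI allI impI, rule ccontr)
  fix p a b
  assume p: "p \<in> proj_zeros {geom (X_eq1 n), geom (X_eq2 n)}"
    and J: "\<forall>i. a * meval (mpderiv i (geom (X_eq1 n))) p + b * meval (mpderiv i (geom (X_eq2 n))) p = 0"
    and ab: "\<not> (a = 0 \<and> b = 0)"
  let ?x = "p Cx" and ?y = "p Cy" and ?u = "p Cu" and ?v = "p Cv" and ?z = "p Cz" and ?c = "to_ac n"
  have p0: "\<not> (?x = 0 \<and> ?y = 0 \<and> ?u = 0 \<and> ?v = 0 \<and> ?z = 0)"
  proof
    assume *: "?x = 0 \<and> ?y = 0 \<and> ?u = 0 \<and> ?v = 0 \<and> ?z = 0"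
    have "p i = 0" for i using * by (cases i) auto
    then show False using p by (auto simp: proj_zeros_def proj_space_def)
  qed
  have E1: "?u ^ 2 = ?x * ?y + ?x * ?z + ?y * ?z - ?c * ?z ^ 2"
    and E2: "?v ^ 2 = ?x * ?y - ?x * ?z - ?y * ?z + ?c * ?z ^ 2"
    using p by (simp_all only: proj_zeros_def mem_Collect_eq ball_simps meval_X_eq1 meval_X_eq2 right_minus_eq simp_thms)
  note d = X_eq1_def X_eq2_def Let_def power2_eq_square mpderiv_add mpderiv_diff mpderiv_mult mpderiv_mvar
  have hx: "(a + b) * ?y = (b - a) * ?z"
    using spec[OF J, of Cx] by (simp add: d algebra_simps)
  have hy: "(a + b) * ?x = (b - a) * ?z"
    using spec[OF J, of Cy] by (simp add: d algebra_simps)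
  have hz: "(a - b) * (?x + ?y - 2 * ?c * ?z) = 0"
    using spec[OF J, of Cz] by (simp add: d algebra_simps)
  have hu: "a = 0 \<or> ?u = 0" using spec[OF J, of Cu] by (simp add: d)
  have hv: "b = 0 \<or> ?v = 0" using spec[OF J, of Cv] by (simp add: d)
  show False
  proof (cases "a = b")
    case True
    then have "?x = 0" "?y = 0" "?u = 0" "?v = 0" using ab hx hy hu hv by auto
    moreover have "?z = 0"
      using E1 calculation to_ac_neqs[OF assms] by simp
    ultimately show False using p0 by simp
  next
    case False
    then have xy: "?x + ?y = 2 * ?c * ?z" using hz by simp
    show False
    proof (cases "a + b = 0")
      case True
      then have "b = - a" by (simp add: add_eq_0_iff)
      then have "a \<noteq> 0" "b \<noteq> 0" using ab by auto
      then have "?u = 0" "?v = 0" "?z = 0" using hu hv hx False True by auto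
      moreover have "?y = - ?x" using xy \<open>?z = 0\<close> by (simp add: add_eq_0_iff)
      moreover have "?x = 0" using E1 calculation by simp
      ultimately show False using p0 by simp
    next
      case s: False
      then have "?x = ?y" using hx hy by (metis mult_left_cancel)
      have "?z \<noteq> 0"
      proof
        assume "?z = 0"
        then have "?x = 0" "?y = 0" using hx hy s by auto
        then have "?u = 0" "?v = 0" using E1 E2 \<open>?z = 0\<close> by auto
        then show False using p0 \<open>?x = 0\<close> \<open>?y = 0\<close> \<open>?z = 0\<close> by simp
      qed
      have "2 * ?y = 2 * (?c * ?z)" using xy unfolding \<open>?x = ?y\<close> by (simp add: mult.assoc)
      then have y: "?y = ?c * ?z" by simp
      have "?u ^ 2 = ?c * (?c + 1) * ?z ^ 2" "?v ^ 2 = ?c * (?c - 1) * ?z ^ 2"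
        unfolding E1 E2 \<open>?x = ?y\<close> y by (simp_all add: algebra_simps power2_eq_square)
      then have "?u \<noteq> 0" "?v \<noteq> 0"
        using to_ac_neqs[OF assms] \<open>?z \<noteq> 0\<close> by (auto simp: eq_neg_iff_add_eq_0)
      then show False using hu hv ab by simp
    qed
  qed
qed

text \<open>Modulo the first form \<open>A - u\<^sup>2\<close> every polynomial is \<open>a + b u\<close> with \<open>a\<close>, \<open>b\<close> free of \<open>u\<close>, and the second form does
  not involve \<open>u\<close>.\<close>

lemma regular_sequence_X:
  assumes "X_eq1 n dvd X_eq2 n * h"
  shows "X_eq1 n dvd h"
proof -
  define u :: "(coord, rat) mpoly" where "u = mvar Cu"
  define A :: "(coord, rat) mpoly" where
    "A = mvar Cx * mvar Cy + mvar Cx * mvar Cz + mvar Cy * mvar Cz - mconst n * mvar Cz ^ 2"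
  have f: "X_eq1 n = A - u^2" by (simp add: X_eq1_def Let_def A_def u_def)
  have "free_of {Cu} A" unfolding A_def by (intro free_of_intros; simp)
  then obtain a b where ab: "free_of {Cu} a" "free_of {Cu} b" "(1 * u^2 - A) dvd (h - (a + b * u))"
    using eliminate_square[of "{}" h Cu A 1] unfolding u_def by auto
  then have red: "X_eq1 n dvd h - (a + b * u)"
    unfolding f by (metis minus_diff_eq minus_dvd_iff mult_1)
  have "X_eq1 n dvd X_eq2 n * h - X_eq2 n * (h - (a + b * u))"
    by (rule dvd_diff[OF assms dvd_mult[OF red]])
  then obtain e where e: "X_eq2 n * (a + b * u) = X_eq1 n * e"
    by (auto simp: algebra_simps elim: dvdE)
  define g where "g = geom (X_eq2 n)"
  have vanish: "meval (geom a * g) p = 0 \<and> meval (geom b * (geom A * g)) p = 0" for p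
  proof -
    obtain r where r: "r ^ 2 = meval (geom A) p" using ex_sqrt by blast
    have *: "meval g p * (meval (geom a) p + meval (geom b) p * s) = 0" if s: "s ^ 2 = r ^ 2" for s
    proof -
      let ?q = "p(Cu := s)"
      have q: "meval (geom f) ?q = meval (geom f) p" if "free_of {Cu} f" for f
        by (rule meval_free_of[OF free_of_geom[OF that]]) simp
      have "meval (geom A) ?q = meval (geom A) p" by (simp add: A_def)
      then have "meval (geom (X_eq1 n)) ?q = 0" by (simp add: f u_def s r)
      moreover have "meval g ?q = meval g p" by (simp add: g_def meval_X_eq2)
      ultimately show ?thesis
        using arg_cong[OF e, of "\<lambda>f. meval (geom f) ?q"] q[OF ab(1)] q[OF ab(2)]
        by (simp add: u_def flip: g_def)
    qed
    have "meval g p * meval (geom a) p = 0 \<and> meval g p * meval (geom b) p * r = 0"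
      using *[OF refl] *[OF power2_minus]
      by (intro add_diff_eq_0_imp)
        (simp_all only: distrib_left right_diff_distrib mult.assoc mult_minus_right add_uminus_conv_diff)
    then show ?thesis by (auto simp flip: r)
  qed
  obtain y :: "rat alg_closure" where y: "y \<in> {2, 3}" "y \<noteq> to_ac n"
    using exists_avoiding by blast
  define p0 where "p0 i = (if i = Cy then y else if i = Cz then 1 else 0)" for i
  have nz: "meval g p0 \<noteq> 0" "meval (geom A * g) p0 \<noteq> 0"
    using y by (auto simp: g_def meval_X_eq2 A_def p0_def)
  have "geom a = 0"
    by (rule meval_eq_0_imp_eq_0, rule irreducible_setD[OF irreducible_set_UNIV _ _ nz(1)])
      (use vanish in auto)
  moreover have "geom b = 0"
    by (rule meval_eq_0_imp_eq_0, rule irreducible_setD[OF irreducible_set_UNIV _ _ nz(2)])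
      (use vanish in auto)
  ultimately show ?thesis using red by simp
qed

lemma exists_generic_point_X: "\<exists>p \<in> surface_X n. meval (generic_X n) p \<noteq> 0"
proof -
  obtain y :: "rat alg_closure" where y: "y \<in> {2, 3}" "y \<noteq> to_ac n"
    using exists_avoiding by blast
  obtain r where r: "r ^ 2 = y - to_ac n" using ex_sqrt by blast
  obtain s where s: "s ^ 2 = to_ac n - y" using ex_sqrt by blast
  define p where "p i = (case i of Cx \<Rightarrow> 0 | Cy \<Rightarrow> y | Cu \<Rightarrow> r | Cv \<Rightarrow> s | Cz \<Rightarrow> 1)" for i
  have "p Cz \<noteq> 0" by (simp add: p_def)
  then have "p \<in> proj_space" by (auto simp: proj_space_def)
  then have "p \<in> surface_X n"
    by (simp add: surface_X_def proj_zeros_def meval_X_eq1 meval_X_eq2 p_def r s)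
  moreover have "meval (generic_X n) p \<noteq> 0"
    using y by (auto simp: generic_X_def p_def)
  ultimately show ?thesis by blast
qed

lemma del_Pezzo_X:
  assumes "n \<notin> {0, 1, -1}"
  shows "del_Pezzo_degree_4 (X_eq1 n) (X_eq2 n)"
  unfolding del_Pezzo_degree_4_def
proof (intro conjI allI impI)
  have UNIV_coord: "(UNIV :: coord set) = {Cx, Cy, Cu, Cv, Cz}"
    using coord.exhaust by auto
  show "CARD(coord) = 5" unfolding UNIV_coord by simp
  show "homogeneous 2 (X_eq1 n)" "homogeneous 2 (X_eq2 n)"
    by (rule homogeneousI, simp add: X_eq1_def X_eq2_def Let_def algebra_simps power2_eq_square)+
  show "X_eq1 n \<noteq> 0"
  proof
    assume "X_eq1 n = 0"
    then have "meval (X_eq1 n) (\<lambda>i. if i = Cu then 1 else 0) = 0" by simp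
    then show False by (simp add: X_eq1_def Let_def)
  qed
qed (use assms regular_sequence_X geometrically_integral_X smooth_X in blast)+

section \<open>Rational maps between the surfaces and the plane\<close>

lemma homogeneous_geom: "homogeneous d f \<Longrightarrow> homogeneous d (geom f)"
  by (auto simp: homogeneous_def in_keys_iff lookup_geom)

lemma irreducible_cone_proj_space:
  "irreducible_cone (proj_space :: ('v \<Rightarrow> 'k::field_char_0) set)"
  by (rule irreducible_set_imp_cone[OF irreducible_set_proj_space])

lemma type_3_cases: "j = 0 \<or> j = 1 \<or> j = 2" for j :: 3
proof (induct j)
  case (of_int z)
  then have "z = 0 \<or> z = 1 \<or> z = 2" by auto
  then show ?case by auto
qed

lemma type_2_cases: "j = 0 \<or> j = 1" for j :: 2
proof (induct j)
  case (of_int z)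
  then have "z = 0 \<or> z = 1" by auto
  then show ?case by auto
qed

lemma generically_plane:
  assumes "\<And>q. par_at n q None \<noteq> 0 \<Longrightarrow> P q"
  shows "generically proj_space P"
proof (rule genericallyI[OF irreducible_cone_proj_space])
  show "homogeneous 8 (geom (par_poly n None))"
    by (intro homogeneous_geom homogeneous_par_poly)
  have "(if (0::3) = 0 then 2 else 1) \<noteq> (0 :: rat alg_closure)" by simp
  then show "(\<lambda>i::3. if i = 0 then 2 else 1) \<in> (proj_space :: (3 \<Rightarrow> rat alg_closure) set)"
    unfolding proj_space_def by (metis (mono_tags, lifting) mem_Collect_eq)
qed (use assms par_at_nonzero in \<open>auto simp: meval_par_poly\<close>)

text \<open>The section is the parametrisation restricted to \<open>u - t v = 1\<close>, that is, to \<open>A = W\<close>.\<close>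

lemma rational_section_X':
  "\<exists>s. rational_section (surface_X' n) (proj_space :: (2 \<Rightarrow> rat alg_closure) set) proj_t s"
proof -
  define s :: "coord' option \<Rightarrow> (2, rat) mpoly" where
    "s = par (mconst n) (mvar 0) (mvar 1) (mvar 1)"
  have s: "meval (geom (s j)) b = par (to_ac n) (b 0) (b 1) (b 1) j" for j b
    by (simp add: s_def geom_par meval_par)
  have map_s: "map_at s b = par (to_ac n) (b 0) (b 1) (b 1)" for b
    by (rule ext) (simp add: map_at_def s)
  have s8: "homogeneous 8 (s j)" for j
    unfolding s_def by (intro homogeneous_par homogeneous_mvar)
  have gen: "generically proj_space P" if "\<And>b. par (to_ac n) (b 0) (b 1) (b 1) None \<noteq> 0 \<Longrightarrow> P b"
    for P :: "(2 \<Rightarrow> rat alg_closure) \<Rightarrow> bool"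
  proof (rule genericallyI[OF irreducible_cone_proj_space])
    show "homogeneous 8 (geom (s None))" by (intro homogeneous_geom s8)
    have "(if (0::2) = 0 then 2 else 1) \<noteq> (0 :: rat alg_closure)" by simp
    then show "(\<lambda>i::2. if i = 0 then 2 else 1) \<in> (proj_space :: (2 \<Rightarrow> rat alg_closure) set)"
      unfolding proj_space_def by (metis (mono_tags, lifting) mem_Collect_eq)
  qed (use that in \<open>auto simp: s\<close>)
  have "rational_section (surface_X' n) proj_space proj_t s"
    unfolding rational_section_def rational_map_def
  proof (intro conjI)
    show "\<exists>d. \<forall>j. homogeneous d (proj_t j)"
      by (intro exI[of _ 1]) (simp add: proj_t_def homogeneous_mvar del: One_nat_def)
    show "generically (surface_X' n) (\<lambda>p. map_at proj_t p \<in> proj_space)"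
    proof (rule generically_everywhere)
      fix p assume "p \<in> surface_X' n"
      then have "map_at proj_t p 1 \<noteq> 0"
        by (simp add: surface_X'_def of_affine_def map_at_def proj_t_def)
      then show "map_at proj_t p \<in> proj_space" by (auto simp: proj_space_def)
    qed
    show "\<exists>d. \<forall>j. homogeneous d (s j)" using s8 by blast
    show "generically proj_space (\<lambda>b. map_at s b \<in> surface_X' n)"
      unfolding map_s by (rule gen) (rule par_mem_surface_X')
    show "generically proj_space (\<lambda>b. proj_eq b (map_at proj_t (map_at s b)))"
    proof (rule gen)
      fix b :: "2 \<Rightarrow> rat alg_closure"
      assume "par (to_ac n) (b 0) (b 1) (b 1) None \<noteq> 0"
      then have "8 * (b 0 ^ 2 - b 1 ^ 2) * b 0 ^ 2 * b 1 ^ 3 \<noteq> 0" by auto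
      moreover have "map_at proj_t (map_at s b) i = 8 * (b 0 ^ 2 - b 1 ^ 2) * b 0 ^ 2 * b 1 ^ 3 * b i" for i
        using type_2_cases[of i]
        by (auto simp: map_at_def[of proj_t] map_s proj_t_def algebra_simps eval_nat_numeral)
      ultimately show "proj_eq b (map_at proj_t (map_at s b))"
        unfolding proj_eq_def by blast
    qed
  qed
  then show ?thesis by blast
qed

text \<open>The inverse of the parametrisation, \<open>(x, t, u, v) \<mapsto> (t : u - t v : 1)\<close>, in homogeneous coordinates.\<close>

definition plane_poly :: "3 \<Rightarrow> (coord' option, rat) mpoly" where
  "plane_poly j = (if j = 0 then mvar (Some Dt) * mvar None
     else if j = 1 then mvar (Some Du) * mvar None - mvar (Some Dt) * mvar (Some Dv)
     else mvar None ^ 2)"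

lemma map_at_plane_poly:
  "map_at plane_poly p 0 = p (Some Dt) * p None"
  "map_at plane_poly p 1 = p (Some Du) * p None - p (Some Dt) * p (Some Dv)"
  "map_at plane_poly p 2 = p None ^ 2"
  by (simp_all add: map_at_def plane_poly_def)

lemma birational_X'_plane: "birational (surface_X' n) (proj_space :: (3 \<Rightarrow> rat alg_closure) set)"
  unfolding birational_def
proof (intro exI conjI)
  have FG: "map_at plane_poly (par_at n q) i
      = 64 * (q 0 ^ 2 - q 2 ^ 2) ^ 2 * q 1 ^ 4 * q 0 ^ 4 * q 2 ^ 3 * q i" for q i
  proof -
    define R where "R = (q 0 ^ 2 + q 2 ^ 2) * (q 0 ^ 2 + q 2 ^ 2 - to_ac n * (q 0 ^ 2 - q 2 ^ 2))"
    define D where "D = q 0 ^ 2 - q 2 ^ 2"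
    have "map_at plane_poly (par_at n q) 0 = 64 * D ^ 2 * q 1 ^ 4 * q 0 ^ 4 * q 2 ^ 3 * q 0"
      unfolding map_at_plane_poly par_at_def par.simps D_def[symmetric]
      by (simp add: algebra_simps eval_nat_numeral)
    moreover have "map_at plane_poly (par_at n q) 1 = 64 * D ^ 2 * q 1 ^ 4 * q 0 ^ 4 * q 2 ^ 3 * q 1"
      unfolding map_at_plane_poly par_at_def par.simps R_def[symmetric] unfolding D_def[symmetric]
      by (simp add: algebra_simps eval_nat_numeral)
    moreover have "map_at plane_poly (par_at n q) 2 = 64 * D ^ 2 * q 1 ^ 4 * q 0 ^ 4 * q 2 ^ 3 * q 2"
      unfolding map_at_plane_poly par_at_def par.simps D_def[symmetric]
      by (simp add: algebra_simps eval_nat_numeral)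
    ultimately show ?thesis
      using type_3_cases[of i] unfolding D_def by auto
  qed
  show "rational_map (surface_X' n) proj_space plane_poly"
    unfolding rational_map_def
  proof
    show "\<exists>d. \<forall>j. homogeneous d (plane_poly j)"
      by (intro exI[of _ 2] allI homogeneousI)
        (simp add: plane_poly_def algebra_simps power2_eq_square)
    show "generically (surface_X' n) (\<lambda>p. map_at plane_poly p \<in> proj_space)"
    proof (rule generically_everywhere)
      fix p assume "p \<in> surface_X' n"
      then have "map_at plane_poly p 2 \<noteq> 0"
        by (simp add: map_at_plane_poly surface_X'_def of_affine_def)
      then show "map_at plane_poly p \<in> proj_space" by (auto simp: proj_space_def)
    qed
  qed
  show "rational_map proj_space (surface_X' n) (par_poly n)"
    unfolding rational_map_def
    using homogeneous_par_poly
    by (auto intro!: generically_plane[of n] simp: map_at_par_poly par_at_mem_surface_X')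
  show "generically proj_space (\<lambda>q. proj_eq q (map_at plane_poly (map_at (par_poly n) q)))"
  proof (rule generically_plane[of n])
    fix q assume "par_at n q None \<noteq> 0"
    then have "64 * (q 0 ^ 2 - q 2 ^ 2) ^ 2 * q 1 ^ 4 * q 0 ^ 4 * q 2 ^ 3 \<noteq> 0"
      by (auto simp: par_at_None)
    then show "proj_eq q (map_at plane_poly (map_at (par_poly n) q))"
      unfolding proj_eq_def map_at_par_poly using FG by blast
  qed
  let ?g = "mvar (Some Dt) * (mvar (Some Du) * mvar None - mvar (Some Dt) * mvar (Some Dv))
    :: (coord' option, rat alg_closure) mpoly"
  show "generically (surface_X' n) (\<lambda>p. proj_eq p (map_at (par_poly n) (map_at plane_poly p)))"
  proof (rule genericallyI[OF irreducible_cone_X'])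
    show "surface_X' n \<subseteq> proj_space"
      by (auto simp: surface_X'_def of_affine_def proj_space_def)
    show "homogeneous 3 ?g"
      by (rule homogeneousI) (simp add: algebra_simps eval_nat_numeral)
    let ?q = "(\<lambda>i. if i = 0 then 2 else 1) :: 3 \<Rightarrow> rat alg_closure"
    show "par_at n ?q \<in> surface_X' n"
      by (rule par_at_mem_surface_X'[OF par_at_nonzero])
    have "map_at plane_poly (par_at n ?q) 1 \<noteq> 0" unfolding FG by simp
    moreover have "par_at n ?q (Some Dt) \<noteq> 0" by (simp add: par_at_def)
    ultimately show "meval ?g (par_at n ?q) \<noteq> 0" by (simp add: map_at_plane_poly)
    fix p assume p: "p \<in> surface_X' n" and g: "meval ?g p \<noteq> 0"
    define w where "w = p None"
    define p' where "p' = (\<lambda>i. p (Some i) / w)"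
    have w: "w \<noteq> 0" and p': "p' \<in> affine_X' n"
      using p by (simp_all add: surface_X'_def of_affine_def w_def p'_def)
    have pS: "p (Some i) = w * p' i" for i using w by (simp add: p'_def)
    have "p' Dt \<noteq> 0" "p' Du \<noteq> p' Dt * p' Dv"
      using g w by (auto simp: pS simp flip: w_def)
    note inv = par_inverse[OF p' this]
    define P where "P = par (to_ac n) (p' Dt) (p' Du - p' Dt * p' Dv) 1"
    have "map_at (par_poly n) (map_at plane_poly p) j = w ^ 16 * P j" for j
    proof -
      have "map_at (par_poly n) (map_at plane_poly p) j
          = par (to_ac n) (w^2 * p' Dt) (w^2 * (p' Du - p' Dt * p' Dv)) (w^2 * 1) j"
        unfolding map_at_par_poly par_at_def map_at_plane_poly
        by (simp add: pS algebra_simps power2_eq_square flip: w_def)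
      then show ?thesis unfolding par_scale P_def by (simp flip: power_mult)
    qed
    moreover have "w ^ 16 * P j = w ^ 15 * P None * p j" for j
    proof (cases j)
      case None
      then show ?thesis by (simp add: eval_nat_numeral flip: w_def)
    next
      case (Some i)
      then show ?thesis using inv(2)[of i] by (simp add: pS eval_nat_numeral flip: P_def)
    qed
    moreover have "w ^ 15 * P None \<noteq> 0" using w inv(1) by (simp add: P_def)
    ultimately show "proj_eq p (map_at (par_poly n) (map_at plane_poly p))"
      unfolding proj_eq_def by (intro exI[of _ "w ^ 15 * P None"]) simp
  qed
qed

lemma homogeneous_generic_X: "homogeneous 5 (generic_X n)"
  by (rule homogeneousI) (simp add: generic_X_def algebra_simps eval_nat_numeral)

lemma zariski_dense_in_X:
  assumes "S \<subseteq> surface_X n" "\<And>q. par_at n q None \<noteq> 0 \<Longrightarrow> toX (par_at n q) \<in> S"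
  shows "zariski_dense_in (surface_X n) S"
proof -
  obtain p0 where p0: "p0 \<in> surface_X n" "meval (generic_X n) p0 \<noteq> 0"
    using exists_generic_point_X by blast
  show ?thesis
  proof (rule zariski_dense_in_nonvanishing[OF irreducible_cone_X homogeneous_generic_X p0 assms(1)])
    fix f e p
    assume f: "\<forall>q\<in>S. meval f q = 0" and p: "p \<in> surface_X n" "meval (generic_X n) p \<noteq> 0"
    obtain q where "par_at n q None \<noteq> 0" "toX (par_at n q) = p"
      using generic_X_eq_toX_par_at surface_X_zeros[OF p(1)] p(2) by blast
    then have "p \<in> S" using assms(2) by blast
    then show "meval f p = 0" using f by blast
  qed
qed

lemma dominant_X'_X: "dominant_rational_map (surface_X' n) (surface_X n) X'_to_X"
  unfolding dominant_rational_map_def rational_map_def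
proof (intro conjI)
  show "\<exists>d. \<forall>j. homogeneous d (X'_to_X j)"
    using homogeneous_toX[of 1 mvar] homogeneous_mvar unfolding X'_to_X_eq by blast
  show "generically (surface_X' n) (\<lambda>p. map_at X'_to_X p \<in> surface_X n)"
    using base_change_square(1) by (rule generically_everywhere)
  show "zariski_dense_in (surface_X n)
      (map_at X'_to_X ` {p \<in> surface_X' n. map_at X'_to_X p \<in> surface_X n})"
  proof (rule zariski_dense_in_X)
    fix q assume "par_at n q None \<noteq> 0"
    then have "par_at n q \<in> surface_X' n" by (rule par_at_mem_surface_X')
    then have "map_at X'_to_X (par_at n q) \<in> map_at X'_to_X ` {p \<in> surface_X' n. map_at X'_to_X p \<in> surface_X n}"
      using base_change_square(1) by blast
    then show "toX (par_at n q) \<in> map_at X'_to_X ` {p \<in> surface_X' n. map_at X'_to_X p \<in> surface_X n}"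
      by (simp only: map_at_X'_to_X)
  qed auto
qed

lemma dominant_plane_X:
  "dominant_rational_map (proj_space :: (3 \<Rightarrow> rat alg_closure) set) (surface_X n) (X_poly n)"
  unfolding dominant_rational_map_def rational_map_def
proof (intro conjI)
  show "\<exists>d. \<forall>j. homogeneous d (X_poly n j)"
    using homogeneous_X_poly by blast
  show "generically proj_space (\<lambda>q. map_at (X_poly n) q \<in> surface_X n)"
    unfolding map_at_X_poly by (rule generically_plane[of n]) (rule toX_par_at_mem_surface_X)
  show "zariski_dense_in (surface_X n)
      (map_at (X_poly n) ` {p \<in> proj_space. map_at (X_poly n) p \<in> surface_X n})"
  proof (rule zariski_dense_in_X)
    fix q assume q: "par_at n q None \<noteq> 0"
    then have "q \<in> proj_space" by (auto simp: proj_space_def par_at_None)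
    with q show "toX (par_at n q) \<in> map_at (X_poly n) ` {p \<in> proj_space. map_at (X_poly n) p \<in> surface_X n}"
      using toX_par_at_mem_surface_X by (force simp: map_at_X_poly)
  qed auto
qed

theorem mainTheorem5:
  shows "\<forall>\<^sub>\<infinity>n::rat.
    smooth_codim2 (X_eq1 n) (X_eq2 n) \<and>
    del_Pezzo_degree_4 (X_eq1 n) (X_eq2 n) \<and>
    geometrically_integral (X'_eq1 n) (X'_eq2 n) \<and>
    (\<exists>s. rational_section (surface_X' n) (proj_space :: (2 \<Rightarrow> rat alg_closure) set) proj_t s) \<and>
    birational (surface_X' n) (proj_space :: (3 \<Rightarrow> rat alg_closure) set) \<and>
    dominant_rational_map (surface_X' n) (surface_X n) X'_to_X \<and>
    (\<exists>f. dominant_rational_map (proj_space :: (3 \<Rightarrow> rat alg_closure) set) (surface_X n) f)"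
    (is "\<forall>\<^sub>\<infinity>n. ?P n")
proof -
  have "?P n" if "n \<notin> {0, 1, -1}" for n
    using smooth_X[OF that] del_Pezzo_X[OF that] geometrically_integral_X' rational_section_X'
      birational_X'_plane dominant_X'_X dominant_plane_X by blast
  then have "{n. \<not> ?P n} \<subseteq> {0, 1, -1}" by blast
  then have "finite {n. \<not> ?P n}" by (rule finite_subset) simp
  then show ?thesis by (simp only: MOST_iff_cofinite)
qed

end
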